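(* Suppose that $P \in \bar{\mathfrak{P}}_+ \setminus \{0\}$ and $c \in \mathfrak{C}_+$. Let $\hat{Q}$ be the unique minimizer over $Q\in\bar{\mathfrak{P}}_+$ of $$\mathbb{J}_P(Q) = \langle c, q \rangle - \int_{\mathbb{T}^d} P(e^{i\boldsymbol{\theta}}) \log Q(e^{i\boldsymbol{\theta}})\, dm(\boldsymbol{\theta}),$$ and, for $\mathbf{N}=(N_1,\dots,N_d)$ with $\min(\mathbf{N})$ sufficiently large (so that minimizers exist), let $\hat{Q}_{\mathbf{N}}$ be a minimizer over $Q\in\bar{\mathfrak{P}}_+(\mathbf{N})$ of $$\mathbb{J}_P^{\mathbf{N}}(Q)=\langle c, q \rangle - \frac{1}{\prod_{j=1}^d N_j}\sum_{\boldsymbol{\ell} \in \mathbb{Z}^d_{\mathbf{N}}} P(\boldsymbol{\zeta}_{\boldsymbol{\ell}}) \log Q(\boldsymbol{\zeta}_{\boldsymbol{\ell}}).$$ Then $$\lim_{\min(\mathbf{N}) \rightarrow \infty} \hat{Q}_{\mathbf{N}} = \hat{Q}$$ uniformly on $\mathbb{T}^d$.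
   Context: Let $d\ge 1$, $\mathbb{T}=(-\pi,\pi]$, $\boldsymbol{\theta}=(\theta_1,\dots,\theta_d)$, $e^{i\boldsymbol{\theta}}=(e^{i\theta_1},\dots,e^{i\theta_d})$, $(\mathbf{k},\boldsymbol{\theta})=\sum_{j=1}^d k_j\theta_j$, and $dm(\boldsymbol{\theta})=(1/2\pi)^d\prod_{j=1}^d d\theta_j$. The index set $\Lambda\subset\mathbb{Z}^d$ is finite with $0\in\Lambda$ and $-\Lambda=\Lambda$. Trigonometric polynomials are $P(e^{i\boldsymbol{\theta}})=\sum_{\mathbf{k}\in\Lambda}p_{\mathbf{k}}e^{-i(\mathbf{k},\boldsymbol{\theta})}$ with $p_{-\mathbf{k}}=\bar p_{\mathbf{k}}$ (real valued), identified with their coefficient vector $p=(p_{\mathbf{k}})_{\mathbf{k}\in\Lambda}$ (similarly $Q\leftrightarrow q$). $\mathfrak{P}_+$ is the convex cone of such polynomials that are positive for all $\boldsymbol{\theta}\in\mathbb{T}^d$; $\bar{\mathfrak{P}}_+$ is its closure. Sequences $c=(c_{\mathbf{k}})_{\mathbf{k}\in\Lambda}$ are complex with $c_{-\mathbf{k}}=\bar c_{\mathbf{k}}$; $\langle c,p\rangle=\sum_{\mathbf{k}\in\Lambda}c_{\mathbf{k}}\bar p_{\mathbf{k}}$. $\mathfrak{C}_+=\{c\mid\langle c,p\rangle>0\text{ for all }P\in\bar{\mathfrak{P}}_+\setminus\{0\}\}$. For $c\in\mathfrak{C}_+$ and $P\in\bar{\mathfrak{P}}_+\setminus\{0\}$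 the functional $\mathbb{J}_P$ has a unique minimizer over $\bar{\mathfrak{P}}_+$ (with $\mathbb{J}_P(0)=+\infty$). For positive integers $\mathbf{N}=(N_1,\dots,N_d)$: $\min(\mathbf{N})=\min_jN_j$, $\mathbb{Z}^d_{\mathbf{N}}=\{\boldsymbol{\ell}=(\ell_1,\dots,\ell_d)\mid 0\le\ell_j\le N_j-1\}$, $\boldsymbol{\zeta}_{\boldsymbol{\ell}}=(e^{2\pi i\ell_1/N_1},\dots,e^{2\pi i\ell_d/N_d})$; $\mathfrak{P}_+(\mathbf{N})$ is the cone of trigonometric polynomials $P(e^{i\boldsymbol{\theta}})=\sum_{\mathbf{k}\in\Lambda}p_{\mathbf{k}}e^{-i(\mathbf{k},\boldsymbol{\theta})}$, $p_{-\mathbf{k}}=\bar p_{\mathbf{k}}$, with $P(\boldsymbol{\zeta}_{\boldsymbol{\ell}})>0$ for all $\boldsymbol{\ell}\in\mathbb{Z}^d_{\mathbf{N}}$, and $\bar{\mathfrak{P}}_+(\mathbf{N})$ is its closure; $\mathfrak{C}_+(\mathbf{N})=\{c\mid\langle c,p\rangle>0\text{ for all }P\in\bar{\mathfrak{P}}_+(\mathbf{N})\setminus\{0\}\}$. The expression $P\log Q$ is defined to be zero at grid points where $P=0$. A minimizer of $\mathbb{J}_P^{\mathbf{N}}$ exists whenever $2n_j<N_j$ for all $j$, where $n_j=\max\{k_j\mid\mathbf{k}\in\Lambda\}$, and $c\in\mathfrak{C}_+(\mathbf{N})$; for $c\in\mathfrak{C}_+$ this holds for all $\mathbf{N}$ with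 $\min(\mathbf{N})$ sufficiently large. *)

theory Defs
  imports "HOL-Analysis.Analysis"
begin

definition torus :: "(real ^ 'd) set" where
  "torus = {\<theta>. \<forall>j. - pi < \<theta> $ j \<and> \<theta> $ j \<le> pi}"

text \<open>
  Index vectors are of type \<^typ>\<open>int ^ 'd\<close>. A sequence indexed by \<open>\<Lambda>\<close> is a total function
  vanishing outside \<open>\<Lambda>\<close>, so that functions and sequences correspond bijectively.
\<close>

definition hermitian_seqs :: "(int ^ 'd) set \<Rightarrow> (int ^ 'd \<Rightarrow> complex) set" where
  "hermitian_seqs \<Lambda> =
     {p. (\<forall>k. k \<notin> \<Lambda> \<longrightarrow> p k = 0) \<and> (\<forall>k\<in>\<Lambda>. p (- k) = cnj (p k))}"

text \<open>
  The value at \<open>(e\<^sup>i\<^sup>\<theta>\<^sub>1, \<dots>, e\<^sup>i\<^sup>\<theta>\<^sub>d)\<close> is written as a function of the angles \<open>\<theta>\<close>, which need not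
  lie in \<^term>\<open>torus\<close>.
\<close>

definition trig_poly :: "(int ^ 'd) set \<Rightarrow> (int ^ 'd \<Rightarrow> complex) \<Rightarrow> real ^ 'd \<Rightarrow> complex" where
  "trig_poly \<Lambda> p \<theta> =
     (\<Sum>k\<in>\<Lambda>. p k * exp (- \<i> * complex_of_real (\<Sum>j\<in>UNIV. of_int (k $ j) * \<theta> $ j)))"

definition pairing :: "(int ^ 'd) set \<Rightarrow> (int ^ 'd \<Rightarrow> complex) \<Rightarrow> (int ^ 'd \<Rightarrow> complex) \<Rightarrow> complex" where
  "pairing \<Lambda> c p = (\<Sum>k\<in>\<Lambda>. c k * cnj (p k))"

text \<open>
  Both quantities are real on the sequences considered, so that taking real parts below
  loses nothing.
\<close>

lemma pairing_real:
  assumes "uminus ` \<Lambda> = \<Lambda>" "c \<in> hermitian_seqs \<Lambda>" "p \<in> hermitian_seqs \<Lambda>"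
  shows "pairing \<Lambda> c p \<in> \<real>"
proof -
  have "cnj (pairing \<Lambda> c p) = (\<Sum>k\<in>\<Lambda>. c (- k) * cnj (p (- k)))"
    using assms by (auto simp: pairing_def hermitian_seqs_def intro!: sum.cong)
  also have "\<dots> = (\<Sum>k\<in>uminus ` \<Lambda>. c k * cnj (p k))"
    by (simp add: sum.reindex)
  finally show ?thesis
    using assms(1) by (simp add: pairing_def Reals_cnj_iff)
qed

lemma trig_poly_real:
  assumes "uminus ` \<Lambda> = \<Lambda>" "p \<in> hermitian_seqs \<Lambda>"
  shows "trig_poly \<Lambda> p \<theta> \<in> \<real>"
proof -
  let ?e = "\<lambda>k. exp (- \<i> * complex_of_real (\<Sum>j\<in>UNIV. of_int (k $ j) * \<theta> $ j))"
  have "cnj (p k * ?e k) = p (- k) * ?e (- k)" if "k \<in> \<Lambda>" for k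
    using assms that by (simp add: hermitian_seqs_def exp_cnj sum_negf)
  then have "cnj (trig_poly \<Lambda> p \<theta>) = (\<Sum>k\<in>\<Lambda>. p (- k) * ?e (- k))"
    unfolding trig_poly_def cnj_sum by (intro sum.cong) auto
  also have "\<dots> = (\<Sum>k\<in>uminus ` \<Lambda>. p k * ?e k)"
    by (simp add: sum.reindex)
  finally show ?thesis
    using assms(1) by (simp add: trig_poly_def Reals_cnj_iff)
qed

definition pos_cone :: "(int ^ 'd) set \<Rightarrow> (int ^ 'd \<Rightarrow> complex) set" where
  "pos_cone \<Lambda> = {p \<in> hermitian_seqs \<Lambda>. \<forall>\<theta>\<in>torus. 0 < Re (trig_poly \<Lambda> p \<theta>)}"

text \<open>
  Closures are taken in the product topology on functions; on the sequences supported in a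
  finite set \<open>\<Lambda>\<close>, which form a closed subspace, this is the usual topology of a
  finite-dimensional space.
\<close>

definition dual_cone :: "(int ^ 'd) set \<Rightarrow> (int ^ 'd \<Rightarrow> complex) set" where
  "dual_cone \<Lambda> = {c \<in> hermitian_seqs \<Lambda>.
     \<forall>p \<in> closure (pos_cone \<Lambda>) - {\<lambda>_. 0}. 0 < Re (pairing \<Lambda> c p)}"

definition grid :: "nat ^ 'd \<Rightarrow> (nat ^ 'd) set" where
  "grid N = {l. \<forall>j. l $ j < N $ j}"

definition grid_angle :: "nat ^ 'd \<Rightarrow> nat ^ 'd \<Rightarrow> real ^ 'd" where
  "grid_angle N l = (\<chi> j. 2 * pi * real (l $ j) / real (N $ j))"

definition pos_cone_grid :: "(int ^ 'd) set \<Rightarrow> nat ^ 'd \<Rightarrow> (int ^ 'd \<Rightarrow> complex) set" where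
  "pos_cone_grid \<Lambda> N =
     {p \<in> hermitian_seqs \<Lambda>. \<forall>l\<in>grid N. 0 < Re (trig_poly \<Lambda> p (grid_angle N l))}"

text \<open>
  \<open>x log y\<close> for \<open>x, y \<ge> 0\<close> with \<open>log 0 = -\<infinity>\<close> and \<open>0 log y = 0\<close>, so that both functionals below
  take values in \<open>(-\<infinity>, \<infinity>]\<close>.
\<close>

definition mult_log :: "real \<Rightarrow> real \<Rightarrow> ereal" where
  "mult_log x y = (if x = 0 then 0 else if y > 0 then ereal (x * ln y) else - \<infinity>)"

text \<open>
  The Lebesgue integral of an extended real function as the integral of its positive part minus
  that of its negative part (\<^const>\<open>e2ennreal\<close> maps negative numbers to \<open>0\<close>). The integrand
  \<open>P log Q\<close> below is bounded above on a set of finite measure, so the first integral is finite and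
  the difference is meaningful. For \<open>Q = 0\<close> and \<open>P \<noteq> 0\<close> it is \<open>-\<infinity>\<close>, so the functional is \<open>\<infinity>\<close> there.
\<close>

definition ext_integral :: "'a measure \<Rightarrow> ('a \<Rightarrow> ereal) \<Rightarrow> ereal" where
  "ext_integral M f =
     enn2ereal (\<integral>\<^sup>+ x. e2ennreal (f x) \<partial>M) - enn2ereal (\<integral>\<^sup>+ x. e2ennreal (- f x) \<partial>M)"

definition J_cont :: "(int ^ 'd) set \<Rightarrow> (int ^ 'd \<Rightarrow> complex) \<Rightarrow> (int ^ 'd \<Rightarrow> complex) \<Rightarrow>
    (int ^ 'd \<Rightarrow> complex) \<Rightarrow> ereal" where
  "J_cont \<Lambda> c P Q = ereal (Re (pairing \<Lambda> c Q)) -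
     ereal ((1 / (2 * pi)) ^ CARD('d)) *
     ext_integral (restrict_space lborel torus)
       (\<lambda>\<theta>. mult_log (Re (trig_poly \<Lambda> P \<theta>)) (Re (trig_poly \<Lambda> Q \<theta>)))"

definition J_grid :: "(int ^ 'd) set \<Rightarrow> (int ^ 'd \<Rightarrow> complex) \<Rightarrow> (int ^ 'd \<Rightarrow> complex) \<Rightarrow>
    nat ^ 'd \<Rightarrow> (int ^ 'd \<Rightarrow> complex) \<Rightarrow> ereal" where
  "J_grid \<Lambda> c P N Q = ereal (Re (pairing \<Lambda> c Q)) -
     ereal (1 / (\<Prod>j\<in>UNIV. real (N $ j))) *
     (\<Sum>l\<in>grid N. mult_log (Re (trig_poly \<Lambda> P (grid_angle N l)))
                           (Re (trig_poly \<Lambda> Q (grid_angle N l))))"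

text \<open>
  The filter for \<open>min(N) \<rightarrow> \<infinity>\<close>. Vectors \<open>N\<close> with a zero entry are irrelevant, since
  \<open>min(N) \<ge> 1\<close> holds eventually.
\<close>

definition min_at_top :: "(nat ^ 'd) filter" where
  "min_at_top = filtercomap (\<lambda>N. Min (range (\<lambda>j. N $ j))) at_top"

end

theory Submission
  imports Defs "HOL-Complex_Analysis.Conformal_Mappings"
begin

text \<open>
  The minimizers \<open>Q\<^sub>N\<close> of the grid functionals are bounded, because \<open>\<langle>c, q\<rangle>\<close> grows linearly on the grid
  cones once the mesh is small, while the logarithmic term grows only logarithmically. Fix \<open>e > 0\<close>. For
  a fine mesh, both \<open>A = Q\<^sub>N + e\<close> and \<open>B = Qhat + e\<close> are bounded away from zero on the whole torus, where
  Riemann sums of \<open>P log A\<close> and \<open>P log B\<close> converge at a rate depending only on \<open>e\<close> and the bound on the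
  coefficients. Adding \<open>e\<close> raises either functional by at most \<open>e c\<^sub>0\<close>, so \<open>A\<close> nearly minimizes the
  grid functional and \<open>B\<close> nearly minimizes the integral functional, both among strictly positive
  polynomials. Comparing them with the midpoint \<open>(A + B) / 2\<close>, the strong concavity of the logarithm on
  bounded intervals makes the grid mean of \<open>P (Q\<^sub>N - Qhat)\<^sup>2\<close> at most of order \<open>e\<close>, hence also
  the integral of this function. Since \<open>P\<close> vanishes on no open set, that integral is a positive
  definite quadratic form in the coefficients of \<open>Q\<^sub>N - Qhat\<close>.
\<close>

section \<open>Riemann sums on the torus\<close>

definition near :: "real \<Rightarrow> real ^ 'd \<Rightarrow> real ^ 'd \<Rightarrow> bool" where
  "near h x y \<longleftrightarrow> (\<forall>j. \<bar>x $ j - y $ j\<bar> \<le> h)"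

definition periodic :: "(real ^ 'd \<Rightarrow> 'a) \<Rightarrow> bool" where
  "periodic f \<longleftrightarrow> (\<forall>x (z :: int ^ 'd). f (x + (\<chi> j. 2 * pi * of_int (z $ j))) = f x)"

text \<open>Positivity is demanded separately: for \<open>N $ j = 0\<close> the quotient is
  \<open>0\<close>, and the mesh bound would hold for every \<open>h \<ge> 0\<close>.\<close>

definition fine_grid :: "nat ^ 'd \<Rightarrow> real \<Rightarrow> bool" where
  "fine_grid N h \<longleftrightarrow> (\<forall>j. 0 < N $ j \<and> 2 * pi / real (N $ j) \<le> h)"

definition grid_mean :: "nat ^ 'd \<Rightarrow> (real ^ 'd \<Rightarrow> real) \<Rightarrow> real" where
  "grid_mean N f = (1 / (\<Prod>j\<in>UNIV. real (N $ j))) * (\<Sum>l\<in>grid N. f (grid_angle N l))"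

abbreviation torus_measure :: "(real ^ 'd) measure" where
  "torus_measure \<equiv> restrict_space lborel torus"

definition torus_mean :: "(real ^ 'd \<Rightarrow> real) \<Rightarrow> real" where
  "torus_mean f = (1 / (2 * pi)) ^ CARD('d) * integral\<^sup>L torus_measure f"

lemma fine_grid_pos:
  assumes "fine_grid N h"
  shows "0 < h"
proof -
  fix j
  have "0 < 2 * pi / real (N $ j)" "2 * pi / real (N $ j) \<le> h"
    using assms by (simp_all add: fine_grid_def)
  then show ?thesis
    by (rule less_le_trans)
qed

lemma periodic_cong:
  assumes "periodic f" "\<And>j. \<exists>z. x $ j = y $ j + 2 * pi * of_int z"
  shows "f x = f y"
proof -
  obtain z where z: "x $ j = y $ j + 2 * pi * of_int (z j)" for j
    using assms(2) by metis
  then have "x = y + (\<chi> j. 2 * pi * of_int ((\<chi> i. z i) $ j))"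
    by (simp add: vec_eq_iff)
  then show ?thesis
    using assms(1) unfolding periodic_def by metis
qed

lemma eventually_fine:
  assumes "0 < h"
  shows "\<forall>\<^sub>F N :: nat ^ 'd in min_at_top. fine_grid N h"
proof -
  define n where "n = Suc (nat \<lceil>2 * pi / h\<rceil>)"
  have "fine_grid N h" if "n \<le> Min (range (\<lambda>j. N $ j))" for N :: "nat ^ 'd"
    unfolding fine_grid_def
  proof
    fix j
    have n: "n \<le> N $ j"
      using that by (simp add: Min_ge_iff)
    then have pos: "0 < N $ j"
      by (simp add: n_def)
    have "2 * pi / h \<le> real n"
      unfolding n_def by linarith
    also have "\<dots> \<le> real (N $ j)"
      using n by simp
    finally show "0 < N $ j \<and> 2 * pi / real (N $ j) \<le> h"
      using pos assms by (simp add: field_simps)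
  qed
  then show ?thesis
    unfolding min_at_top_def eventually_filtercomap
    by (intro exI[of _ "\<lambda>m. n \<le> m"]) (auto simp: eventually_ge_at_top)
qed

section \<open>Counting grid points and rounding to them\<close>

lemma finite_grid [simp]: "finite (grid N)"
proof -
  have "grid N \<subseteq> vec_lambda ` (PiE UNIV (\<lambda>j. {..<N $ j}))"
  proof
    fix l assume "l \<in> grid N"
    then have "(\<lambda>j. l $ j) \<in> PiE UNIV (\<lambda>j. {..<N $ j})"
      by (auto simp: grid_def)
    then show "l \<in> vec_lambda ` (PiE UNIV (\<lambda>j. {..<N $ j}))"
      by (metis image_eqI vec_nth_inverse vec_lambda_eta)
  qed
  then show ?thesis
    by (rule finite_subset) (simp add: finite_PiE)
qed

lemma card_grid: "card (grid N) = (\<Prod>j\<in>UNIV. N $ j)"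
proof -
  have "bij_betw vec_lambda (PiE UNIV (\<lambda>j. {..<N $ j})) (grid N)"
    by (rule bij_betw_byWitness[where f' = "\<lambda>l j. l $ j"]) (auto simp: grid_def)
  then show ?thesis
    by (simp add: bij_betw_same_card[symmetric] card_PiE)
qed

text \<open>Take the floor \<open>r\<close> of \<open>x * n / (2 * pi)\<close> and divide it by
  \<open>n\<close>: the remainder is the grid index \<open>l\<close>, the quotient is the number
  \<open>z\<close> of full turns.\<close>

lemma rounding_int:
  fixes x :: real and n :: nat
  assumes "0 < n"
  shows "\<exists>l<n. \<exists>z::int. \<bar>x - (2 * pi * real l / real n + 2 * pi * of_int z)\<bar> \<le> 2 * pi / real n"
proof -
  define r where "r = \<lfloor>x * real n / (2 * pi)\<rfloor>"
  have r: "of_int r \<le> x * real n / (2 * pi)" "x * real n / (2 * pi) < of_int r + 1"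
    by (simp_all add: r_def)
  define l where "l = nat (r mod int n)"
  have l: "l < n"
    using assms by (simp add: l_def nat_less_iff)
  have "int l = r mod int n"
    using assms by (simp add: l_def)
  then have "r = int l + int n * (r div int n)"
    by simp
  then have "real_of_int r = real l + real n * real_of_int (r div int n)"
    by (metis of_int_add of_int_mult of_int_of_nat_eq)
  then have eq: "2 * pi * real l / real n + 2 * pi * of_int (r div int n) = 2 * pi * of_int r / real n"
    using assms by (simp add: field_simps)
  have "2 * pi * of_int r / real n \<le> x" "x \<le> 2 * pi * of_int r / real n + 2 * pi / real n"
    using r assms by (simp_all add: field_simps)
  then show ?thesis
    using l eq by (intro exI[of _ l] conjI exI[of _ "r div int n"]) auto
qed

text \<open>The nearby point \<open>y\<close> belongs to the periodically extended grid and need not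
  be a grid angle itself; periodicity of \<open>f\<close> carries its value back to
  \<open>grid N\<close>.\<close>

lemma rounding_grid:
  assumes "fine_grid N h" "periodic f"
  obtains l y where "l \<in> grid N" "near h \<theta> y" "f y = f (grid_angle N l)"
proof -
  have "\<forall>j. \<exists>l z. l < N $ j \<and>
      \<bar>\<theta> $ j - (2 * pi * real l / real (N $ j) + 2 * pi * of_int z)\<bar> \<le> 2 * pi / real (N $ j)"
    using assms rounding_int by (metis fine_grid_def)
  then obtain l z where lz: "l j < N $ j"
      "\<bar>\<theta> $ j - (2 * pi * real (l j) / real (N $ j) + 2 * pi * of_int (z j))\<bar> \<le> 2 * pi / real (N $ j)"
    for j by metis
  define y where "y = (\<chi> j. 2 * pi * real (l j) / real (N $ j) + 2 * pi * of_int (z j))"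
  show thesis
  proof (rule that[of "\<chi> j. l j" y])
    show "(\<chi> j. l j) \<in> grid N"
      by (simp add: grid_def lz)
    show "near h \<theta> y"
      using assms(1) lz(2) by (auto simp: near_def y_def fine_grid_def intro: order_trans)
    show "f y = f (grid_angle N (\<chi> j. l j))"
      by (rule periodic_cong[OF assms(2)]) (auto simp: y_def grid_angle_def)
  qed
qed

section \<open>The torus as a finite measure space\<close>

lemma torus_box:
  "box (\<chi> j. - pi) (\<chi> j. pi) \<subseteq> (torus :: (real ^ 'd) set)"
  "(torus :: (real ^ 'd) set) \<subseteq> cbox (\<chi> j. - pi) (\<chi> j. pi)"
  by (auto simp: torus_def mem_box_cart less_imp_le)

lemma half_open_box_borel [measurable]: "{\<theta> :: real ^ 'd. \<forall>j. a j < \<theta> $ j \<and> \<theta> $ j \<le> b j} \<in> sets borel"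
proof -
  have "closed {\<theta> :: real ^ 'd. \<forall>j. \<theta> $ j \<le> b j}"
    by (intro closed_Collect_all closed_Collect_le continuous_intros)
  moreover have "open {\<theta> :: real ^ 'd. \<forall>j. a j < \<theta> $ j}"
  proof -
    have "{\<theta> :: real ^ 'd. \<forall>j. a j < \<theta> $ j} = (\<Inter>j. {\<theta>. a j < \<theta> $ j})"
      by auto
    then show ?thesis
      by (auto intro!: open_INT open_Collect_less continuous_intros)
  qed
  ultimately have "{\<theta> :: real ^ 'd. \<forall>j. \<theta> $ j \<le> b j} \<inter> {\<theta>. \<forall>j. a j < \<theta> $ j} \<in> sets borel"
    by auto
  also have "{\<theta> :: real ^ 'd. \<forall>j. \<theta> $ j \<le> b j} \<inter> {\<theta>. \<forall>j. a j < \<theta> $ j} =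
      {\<theta>. \<forall>j. a j < \<theta> $ j \<and> \<theta> $ j \<le> b j}"
    by auto
  finally show ?thesis .
qed

text \<open>The half-open box lies between the open and the closed box, which have the same measure.
  Both the torus and its cells are of this shape.\<close>

lemma emeasure_half_open_box:
  assumes "\<And>j. a j \<le> b j"
  shows "emeasure lborel {\<theta> :: real ^ 'd. \<forall>j. a j < \<theta> $ j \<and> \<theta> $ j \<le> b j} = ennreal (\<Prod>j\<in>UNIV. b j - a j)"
    (is "emeasure lborel ?C = _")
proof -
  define l u :: "real ^ 'd" where "l = (\<chi> j. a j)" and "u = (\<chi> j. b j)"
  have le: "\<forall>i\<in>Basis. l \<bullet> i \<le> u \<bullet> i"
    using assms by (auto simp: l_def u_def Basis_vec_def inner_axis)
  have ne: "cbox l u \<noteq> {}"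
    using le by (simp add: box_ne_empty)
  have c: "emeasure lborel (cbox l u) = ennreal (\<Prod>j\<in>UNIV. b j - a j)"
    using content_cbox_cart[OF ne] emeasure_lborel_cbox_finite[of l u]
    by (simp add: emeasure_eq_ennreal_measure l_def u_def)
  have b: "emeasure lborel (box l u) = emeasure lborel (cbox l u)"
    by (simp add: emeasure_lborel_box_eq emeasure_lborel_cbox_eq)
  have "emeasure lborel ?C \<le> emeasure lborel (cbox l u)"
    by (rule emeasure_mono) (auto simp: mem_box_cart l_def u_def less_imp_le)
  moreover have "emeasure lborel (box l u) \<le> emeasure lborel ?C"
    by (rule emeasure_mono) (auto simp: mem_box_cart l_def u_def less_imp_le)
  ultimately show ?thesis
    using b c by simp
qed

lemma torus_sets [simp, measurable]: "torus \<in> sets borel"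
  unfolding torus_def by (rule half_open_box_borel)

lemma space_torus_measure [simp]: "space torus_measure = torus"
  by (simp add: space_restrict_space)

lemma emeasure_torus: "emeasure lborel (torus :: (real ^ 'd) set) = ennreal ((2 * pi) ^ CARD('d))"
  using emeasure_half_open_box[of "\<lambda>j :: 'd. - pi" "\<lambda>j. pi"] by (simp add: torus_def)

lemma measure_torus_measure:
  "measure torus_measure (torus :: (real ^ 'd) set) = (2 * pi) ^ CARD('d)"
  by (simp add: measure_def emeasure_restrict_space emeasure_torus)

lemma finite_torus_measure: "finite_measure torus_measure"
  by (rule finite_measureI) (simp add: emeasure_restrict_space emeasure_torus)

lemma integrable_torus:
  fixes f :: "real ^ 'd \<Rightarrow> 'b :: {banach, second_countable_topology}"
  assumes "continuous_on UNIV f"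
  shows "integrable torus_measure f"
proof -
  have "compact (f ` cbox (\<chi> j. - pi) (\<chi> j. pi))"
    using assms by (intro compact_continuous_image) (auto intro: continuous_on_subset)
  then obtain B where "\<forall>x\<in>f ` cbox (\<chi> j. - pi) (\<chi> j. pi). norm x \<le> B"
    using compact_imp_bounded bounded_iff by blast
  then have "AE x in torus_measure. norm (f x) \<le> B"
    using torus_box(2) by (intro AE_I2) auto
  moreover have "f \<in> borel_measurable torus_measure"
    using borel_measurable_continuous_onI[OF assms] by (intro measurable_restrict_space1) simp
  ultimately show ?thesis
    using finite_measure.integrable_const_bound[OF finite_torus_measure] by blast
qed

section \<open>Riemann sums over a partition into cells\<close>

text \<open>Adding \<open>s\<close> to the indices modulo \<open>N\<close> permutes the grid, and
  the reduction modulo \<open>N\<close> moves the angles by whole periods. This allows recentring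
  the grid, whose angles start at \<open>0\<close>, on the torus, which starts at
  \<open>- pi\<close>.\<close>

lemma grid_shift:
  fixes f :: "real ^ 'd \<Rightarrow> real"
  assumes "\<And>j. 0 < N $ j" "periodic f"
  shows "(\<Sum>l\<in>grid N. f (grid_angle N l)) =
    (\<Sum>m\<in>grid N. f (\<chi> j. 2 * pi * (real (m $ j) - real (s j)) / real (N $ j)))"
proof -
  let ?i = "\<lambda>l. \<chi> j. (l $ j + s j) mod N $ j"
  \<comment> \<open>The inverse shift subtracts in the integers, because subtraction of naturals
    would truncate at \<open>0\<close>.\<close>
  let ?j = "\<lambda>m. \<chi> j. nat ((int (m $ j) - int (s j)) mod int (N $ j))"
  have lt: "nat ((int m - int t) mod int n) < n" if "0 < n" for m t n :: nat
    using that by (simp add: nat_less_iff)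
  have ji: "nat ((int ((l + t) mod n) - int t) mod int n) = l" if "l < n" for l t n :: nat
  proof -
    have "(int ((l + t) mod n) - int t) mod int n = int l mod int n"
      by (simp add: zmod_int mod_diff_left_eq)
    then show ?thesis
      using that by simp
  qed
  have ij: "(nat ((int m - int t) mod int n) + t) mod n = m" if "m < n" for m t n :: nat
  proof -
    have "int ((nat ((int m - int t) mod int n) + t) mod n) = ((int m - int t) mod int n + int t) mod int n"
      using that by (simp add: zmod_int)
    also have "\<dots> = int m"
      using that by (simp add: mod_add_left_eq)
    finally show ?thesis
      by simp
  qed
  show ?thesis
  proof (rule sum.reindex_bij_witness[where i = ?j and j = ?i])
    fix l assume l: "l \<in> grid N"
    show "?j (?i l) = l"
      using l by (simp add: vec_eq_iff grid_def ji)
    show "?i l \<in> grid N"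
      using assms(1) by (simp add: grid_def)
    show "f (\<chi> j. 2 * pi * (real (?i l $ j) - real (s j)) / real (N $ j)) = f (grid_angle N l)"
    proof (rule periodic_cong[OF assms(2)])
      fix j
      have "real (l $ j + s j) = real ((l $ j + s j) mod N $ j) + real (N $ j) * real ((l $ j + s j) div N $ j)"
        by (metis mod_mult_div_eq of_nat_add of_nat_mult)
      then have "real ((l $ j + s j) mod N $ j) - real (s j) =
          real (l $ j) - real (N $ j) * real ((l $ j + s j) div N $ j)"
        by simp
      moreover have "2 * pi * (real (l $ j) - real (N $ j) * real q) / real (N $ j) =
          2 * pi * real (l $ j) / real (N $ j) + 2 * pi * of_int (- int q)" for q
        using assms(1)[of j] by (simp add: field_simps)
      ultimately have eq: "2 * pi * (real ((l $ j + s j) mod N $ j) - real (s j)) / real (N $ j) =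
          2 * pi * real (l $ j) / real (N $ j) + 2 * pi * of_int (- int ((l $ j + s j) div N $ j))"
        by metis
      show "\<exists>z. (\<chi> j. 2 * pi * (real (?i l $ j) - real (s j)) / real (N $ j)) $ j =
          grid_angle N l $ j + 2 * pi * of_int z"
        unfolding grid_angle_def using eq by (intro exI[of _ "- int ((l $ j + s j) div N $ j)"]) simp
    qed
  next
    fix m assume m: "m \<in> grid N"
    show "?i (?j m) = m"
      using m by (simp add: vec_eq_iff grid_def ij)
    show "?j m \<in> grid N"
      using assms(1) by (simp add: grid_def lt)
  qed
qed

text \<open>Open on the left and closed on the right like \<open>torus\<close>, so that the cells
  partition it exactly.\<close>

definition cell :: "nat ^ 'd \<Rightarrow> nat ^ 'd \<Rightarrow> (real ^ 'd) set" where
  "cell N m = {\<theta>. \<forall>j. - pi + 2 * pi * real (m $ j) / real (N $ j) < \<theta> $ j \<and>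
                       \<theta> $ j \<le> - pi + 2 * pi * real (m $ j + 1) / real (N $ j)}"

lemma cell_index_unique:
  assumes "\<And>j. 0 < N $ j" "\<theta> \<in> torus"
  shows "\<exists>!m. m \<in> grid N \<and> \<theta> \<in> cell N m"
proof -
  \<comment> \<open>Cells contain their right end but not their left end, hence the ceiling minus
    one instead of the floor.\<close>
  define m where "m = (\<chi> j. nat (\<lceil>(\<theta> $ j + pi) * real (N $ j) / (2 * pi)\<rceil> - 1))"
  have iff: "- pi + 2 * pi * real k / real (N $ j) < \<theta> $ j \<and>
      \<theta> $ j \<le> - pi + 2 * pi * real (k + 1) / real (N $ j) \<longleftrightarrow> k = m $ j" for k j
  proof -
    have N: "0 < real (N $ j)" and t: "0 < \<theta> $ j + pi"
      using assms by (auto simp: torus_def) (smt (verit))+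
    let ?x = "(\<theta> $ j + pi) * real (N $ j) / (2 * pi)"
    have "?x > 0"
      using N t by simp
    have "- pi + 2 * pi * real k / real (N $ j) < \<theta> $ j \<longleftrightarrow> real k < ?x"
      using N by (simp add: field_simps)
    moreover have "\<theta> $ j \<le> - pi + 2 * pi * real (k + 1) / real (N $ j) \<longleftrightarrow> ?x \<le> real k + 1"
      using N by (simp add: field_simps)
    moreover have "real k < ?x \<and> ?x \<le> real k + 1 \<longleftrightarrow> \<lceil>?x\<rceil> = int k + 1"
      by (simp add: ceiling_eq_iff)
    moreover have "\<lceil>?x\<rceil> = int k + 1 \<longleftrightarrow> k = m $ j"
      using \<open>?x > 0\<close> by (auto simp: m_def)
    ultimately show ?thesis
      by blast
  qed
  have cell: "\<theta> \<in> cell N k \<longleftrightarrow> k = m" for k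
    unfolding cell_def mem_Collect_eq iff by (simp add: vec_eq_iff)
  have "m \<in> grid N"
  proof -
    have "m $ j < N $ j" for j
    proof -
      have "- pi + 2 * pi * real (m $ j) / real (N $ j) < pi"
        using iff[of "m $ j" j] assms(2) unfolding torus_def by (smt (verit) mem_Collect_eq)
      then show ?thesis
        using assms(1)[of j] by (simp add: field_simps)
    qed
    then show ?thesis
      by (simp add: grid_def)
  qed
  then show ?thesis
    unfolding cell by blast
qed

lemma cell_subset_torus:
  assumes "\<And>j. 0 < N $ j" "m \<in> grid N"
  shows "cell N m \<subseteq> torus"
proof
  fix \<theta> assume \<theta>: "\<theta> \<in> cell N m"
  have "- pi < \<theta> $ j \<and> \<theta> $ j \<le> pi" for j
  proof -
    have "m $ j + 1 \<le> N $ j"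
      using assms(2) by (auto simp: grid_def Suc_le_eq)
    then have "real (m $ j + 1) \<le> real (N $ j)"
      by (rule of_nat_mono)
    then have "2 * pi * real (m $ j + 1) \<le> 2 * pi * real (N $ j)"
      by (intro mult_left_mono) auto
    then have "2 * pi * real (m $ j + 1) / real (N $ j) \<le> 2 * pi"
      using assms(1)[of j] by (simp add: pos_divide_le_eq)
    moreover have "0 \<le> 2 * pi * real (m $ j) / real (N $ j)"
      by simp
    ultimately show ?thesis
      using \<theta> unfolding cell_def by (smt (verit) mem_Collect_eq)
  qed
  then show "\<theta> \<in> torus"
    by (simp add: torus_def)
qed

lemma measure_cell:
  fixes N :: "nat ^ 'd"
  assumes "\<And>j. 0 < N $ j" "m \<in> grid N"
  shows "measure torus_measure (cell N m) = (2 * pi) ^ CARD('d) / (\<Prod>j\<in>UNIV. real (N $ j))"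
    "cell N m \<in> sets torus_measure"
proof -
  have sets: "cell N m \<in> sets borel"
    unfolding cell_def by (rule half_open_box_borel)
  then show "cell N m \<in> sets torus_measure"
    using cell_subset_torus[OF assms] by (auto simp: sets_restrict_space image_iff)
  have "emeasure lborel (cell N m) = ennreal (\<Prod>j\<in>UNIV. (- pi + 2 * pi * real (m $ j + 1) / real (N $ j)) -
      (- pi + 2 * pi * real (m $ j) / real (N $ j)))"
    unfolding cell_def by (intro emeasure_half_open_box add_left_mono divide_right_mono mult_left_mono) auto
  also have "(\<Prod>j\<in>UNIV. (- pi + 2 * pi * real (m $ j + 1) / real (N $ j)) -
      (- pi + 2 * pi * real (m $ j) / real (N $ j))) = (\<Prod>j\<in>UNIV. 2 * pi / real (N $ j))"
    by (intro prod.cong) (auto simp: distrib_left add_divide_distrib)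
  finally show "measure torus_measure (cell N m) = (2 * pi) ^ CARD('d) / (\<Prod>j\<in>UNIV. real (N $ j))"
    using sets cell_subset_torus[OF assms]
    by (simp add: measure_def emeasure_restrict_space prod_dividef prod_nonneg)
qed

text \<open>\<open>f\<close> is compared with a step function whose value on each cell is a sample
  of \<open>f\<close> within \<open>h\<close> of every point of the cell. The integral of the step
  function is a multiple of the grid mean, so the oscillation bound \<open>e\<close> passes to the
  means.\<close>

lemma riemann_sum_error:
  fixes N :: "nat ^ 'd"
  assumes N: "fine_grid N h" and cont: "continuous_on UNIV f" and per: "periodic f"
    and osc: "\<And>x y. near h x y \<Longrightarrow> \<bar>f x - f y\<bar> \<le> e"
  shows "\<bar>grid_mean N f - torus_mean f\<bar> \<le> e"
proof -
  interpret finite_measure "torus_measure :: (real ^ 'd) measure"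
    by (rule finite_torus_measure)
  have pos: "0 < N $ j" for j
    using N by (simp add: fine_grid_def)
  \<comment> \<open>Shifting the index by half of \<open>N $ j\<close>, rounded down, puts the
    sample at the left end of the side of the cell for even \<open>N $ j\<close> and at its midpoint
    for odd \<open>N $ j\<close>. Either way it is within one mesh width of the whole side.\<close>
  define x where "x m = (\<chi> j. 2 * pi * (real (m $ j) - real (N $ j div 2)) / real (N $ j))" for m
  define V where "V = (2 * pi) ^ CARD('d)"
  define n where "n = (\<Prod>j\<in>UNIV. real (N $ j))"
  define g where "g \<theta> = (\<Sum>m\<in>grid N. f (x m) * indicator (cell N m) \<theta>)" for \<theta>
  have V: "0 < V" and n: "0 < n"
    using pos by (auto simp: V_def n_def intro!: prod_pos)
  have near: "near h \<theta> (x m)" if "\<theta> \<in> cell N m" for \<theta> m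
    unfolding near_def
  proof
    fix j
    let ?q = "real (N $ j div 2)" and ?n = "real (N $ j)" and ?m = "real (m $ j)"
    have p: "0 < ?n"
      using pos by simp
    have q: "?n - 1 \<le> 2 * ?q" "2 * ?q \<le> ?n"
      by linarith+
    have aux: "\<bar>t - (b - c)\<bar> \<le> d"
      if "c \<le> pi" "pi - c \<le> d / 2" "- pi + b < t" "t \<le> - pi + (b + d)" for t b c d :: real
      using that by linarith
    have "\<bar>\<theta> $ j - (2 * pi * ?m / ?n - 2 * pi * ?q / ?n)\<bar> \<le> 2 * pi / ?n"
    proof (rule aux)
      show "2 * pi * ?q / ?n \<le> pi"
        using p q mult_left_mono[OF q(2), of pi] by (simp add: field_simps)
      show "pi - 2 * pi * ?q / ?n \<le> 2 * pi / ?n / 2"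
      proof -
        have "(pi * ?n - 2 * pi * ?q) / ?n \<le> pi / ?n"
          using mult_left_mono[OF q(1), of pi] by (intro divide_right_mono) (auto simp: algebra_simps)
        then show ?thesis
          using p by (simp add: diff_divide_distrib)
      qed
      show "- pi + 2 * pi * ?m / ?n < \<theta> $ j"
        using that unfolding cell_def by blast
      have "\<theta> $ j \<le> - pi + 2 * pi * real (m $ j + 1) / ?n"
        using that unfolding cell_def by blast
      also have "real (m $ j + 1) = ?m + 1"
        by (rule of_nat_add[of "m $ j" 1, unfolded of_nat_1])
      also have "2 * pi * (?m + 1) / ?n = 2 * pi * ?m / ?n + 2 * pi / ?n"
        by (simp add: distrib_left add_divide_distrib)
      finally show "\<theta> $ j \<le> - pi + (2 * pi * ?m / ?n + 2 * pi / ?n)" .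
    qed
    also have "2 * pi * ?m / ?n - 2 * pi * ?q / ?n = x m $ j"
      by (simp add: x_def right_diff_distrib diff_divide_distrib)
    finally show "\<bar>\<theta> $ j - x m $ j\<bar> \<le> h"
      using N by (meson fine_grid_def order_trans)
  qed
  have g: "\<bar>f \<theta> - g \<theta>\<bar> \<le> e" if \<theta>: "\<theta> \<in> torus" for \<theta>
  proof -
    define m where "m = (THE m. m \<in> grid N \<and> \<theta> \<in> cell N m)"
    have m: "m \<in> grid N" "\<theta> \<in> cell N m"
      using theI'[OF cell_index_unique[OF pos \<theta>]] by (simp_all add: m_def)
    have uniq: "k = m" if "k \<in> grid N" "\<theta> \<in> cell N k" for k
      using the1_equality[OF cell_index_unique[OF pos \<theta>], of k] that by (simp add: m_def)
    have "g \<theta> = (\<Sum>k\<in>grid N. if k = m then f (x m) else 0)"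
      unfolding g_def
    proof (intro sum.cong refl)
      fix k assume k: "k \<in> grid N"
      show "f (x k) * indicator (cell N k) \<theta> = (if k = m then f (x m) else 0)"
      proof (cases "\<theta> \<in> cell N k")
        case True
        then have "k = m"
          by (rule uniq[OF k])
        then show ?thesis
          using True by simp
      next
        case False
        then have "k \<noteq> m"
          using m(2) by metis
        then show ?thesis
          using False by simp
      qed
    qed
    also have "\<dots> = f (x m)"
      using m by simp
    finally show ?thesis
      using osc near m by simp
  qed
  have int_cell: "integrable torus_measure (\<lambda>\<theta>. f (x m) * indicator (cell N m) \<theta>)" if "m \<in> grid N" for m
    using measure_cell(2)[OF pos that]
    by (intro integrable_mult_right integrable_real_indicator) (simp_all add: less_top[symmetric])
  have int_g: "integrable torus_measure g"
    unfolding g_def using int_cell by (intro Bochner_Integration.integrable_sum) auto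
  have int_f: "integrable torus_measure f"
    by (rule integrable_torus[OF cont])
  have "integral\<^sup>L torus_measure g = (\<Sum>m\<in>grid N. integral\<^sup>L torus_measure (\<lambda>\<theta>. f (x m) * indicator (cell N m) \<theta>))"
    unfolding g_def using int_cell by (intro Bochner_Integration.integral_sum) auto
  also have "\<dots> = (\<Sum>m\<in>grid N. f (x m) * (V / n))"
  proof (intro sum.cong refl)
    fix m assume m: "m \<in> grid N"
    have "cell N m \<inter> torus = cell N m"
      using cell_subset_torus[OF pos m] by blast
    then show "integral\<^sup>L torus_measure (\<lambda>\<theta>. f (x m) * indicator (cell N m) \<theta>) = f (x m) * (V / n)"
      using measure_cell[OF pos m] by (simp add: V_def n_def)
  qed
  also have "\<dots> = V * (1 / n * (\<Sum>m\<in>grid N. f (x m)))"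
    by (simp add: sum_distrib_left sum_distrib_right field_simps)
  also have "(\<Sum>m\<in>grid N. f (x m)) = (\<Sum>l\<in>grid N. f (grid_angle N l))"
    unfolding x_def by (rule grid_shift[OF pos per, symmetric])
  finally have ig: "integral\<^sup>L torus_measure g = V * grid_mean N f"
    by (simp add: grid_mean_def n_def)
  have "norm (integral\<^sup>L torus_measure (\<lambda>\<theta>. f \<theta> - g \<theta>)) \<le>
      integral\<^sup>L torus_measure (\<lambda>\<theta>. norm (f \<theta> - g \<theta>))"
    by (rule integral_norm_bound)
  also have "\<dots> \<le> integral\<^sup>L torus_measure (\<lambda>_ :: real ^ 'd. e)"
    using int_f int_g g by (intro Bochner_Integration.integral_mono) auto
  also have "\<dots> = V * e"
    by (simp add: measure_torus_measure V_def)
  finally have "\<bar>integral\<^sup>L torus_measure f - V * grid_mean N f\<bar> \<le> V * e"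
    using int_f int_g ig by simp
  moreover have "integral\<^sup>L torus_measure f = V * torus_mean f"
    by (simp add: torus_mean_def V_def power_divide)
  ultimately have "V * \<bar>torus_mean f - grid_mean N f\<bar> \<le> V * e"
    using V by (simp add: abs_mult flip: right_diff_distrib)
  then show ?thesis
    using V by (simp add: abs_minus_commute)
qed

section \<open>Trigonometric polynomials and their cones\<close>

definition lin_comb :: "real \<Rightarrow> ('k \<Rightarrow> complex) \<Rightarrow> real \<Rightarrow> ('k \<Rightarrow> complex) \<Rightarrow> 'k \<Rightarrow> complex" where
  "lin_comb a p b q = (\<lambda>k. complex_of_real a * p k + complex_of_real b * q k)"

text \<open>The coefficients of the constant polynomial \<open>1\<close>; adding \<open>e\<close>
  times this sequence is the shift by \<open>e\<close>.\<close>

definition unit_seq :: "int ^ 'd \<Rightarrow> complex" where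
  "unit_seq = (\<lambda>k. if k = 0 then 1 else 0)"

text \<open>This norm dominates the values of a polynomial at all angles at once, so convergence in
  it is uniform on the torus.\<close>

definition l1_norm :: "'k set \<Rightarrow> ('k \<Rightarrow> complex) \<Rightarrow> real" where
  "l1_norm \<Lambda> p = (\<Sum>k\<in>\<Lambda>. cmod (p k))"

lemma l1_norm_nonneg: "0 \<le> l1_norm \<Lambda> p"
  by (simp add: l1_norm_def sum_nonneg)

lemma l1_norm_lin_comb: "l1_norm \<Lambda> (lin_comb a p b q) \<le> \<bar>a\<bar> * l1_norm \<Lambda> p + \<bar>b\<bar> * l1_norm \<Lambda> q"
  unfolding l1_norm_def lin_comb_def sum_distrib_left sum.distrib[symmetric]
  by (intro sum_mono order_trans[OF norm_triangle_ineq]) (simp add: norm_mult)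

lemma l1_norm_scale: "l1_norm \<Lambda> (\<lambda>k. complex_of_real t * p k) = \<bar>t\<bar> * l1_norm \<Lambda> p"
  by (simp add: l1_norm_def norm_mult sum_distrib_left)

lemma continuous_on_coordinate [continuous_intros]:
  "continuous_on S (\<lambda>p :: 'k \<Rightarrow> complex. p k)"
  by (rule continuous_on_subset[OF continuous_on_product_coordinates]) simp

text \<open>The elements of \<open>C\<close> of norm \<open>1\<close> form a compact set, on which
  \<open>F\<close> has a positive minimum; homogeneity extends the bound to all of \<open>C\<close>.
  The lemma serves the pairing with \<open>c\<close> for \<open>r = 1\<close> and a quadratic form
  for \<open>r = 2\<close>.\<close>

lemma homogeneous_lower_bound:
  fixes F :: "('k \<Rightarrow> complex) \<Rightarrow> real"
  assumes fin: "finite \<Lambda>" and closed: "closed C" and supp: "\<And>p k. p \<in> C \<Longrightarrow> k \<notin> \<Lambda> \<Longrightarrow> p k = 0"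
    and scale: "\<And>p t. p \<in> C \<Longrightarrow> 0 < t \<Longrightarrow> (\<lambda>k. complex_of_real t * p k) \<in> C"
    and cont: "continuous_on UNIV F"
    and hom: "\<And>p t. 0 < t \<Longrightarrow> F (\<lambda>k. complex_of_real t * p k) = t ^ r * F p"
    and pos: "\<And>p. p \<in> C \<Longrightarrow> p \<noteq> (\<lambda>_. 0) \<Longrightarrow> 0 < F p"
    and zero: "0 < r" "0 \<le> F (\<lambda>_. 0)"
  obtains \<kappa> where "0 < \<kappa>" "\<And>p. p \<in> C \<Longrightarrow> \<kappa> * l1_norm \<Lambda> p ^ r \<le> F p"
proof -
  \<comment> \<open>A product of closed discs and singletons is compact in the product topology,
    however large the index type is.\<close>
  define S where "S k = (if k \<in> \<Lambda> then cball 0 1 else {0 :: complex})" for k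
  define K where "K = C \<inter> {p. l1_norm \<Lambda> p = 1}"
  have "compact (PiE UNIV S)"
    using compactin_PiE[of "\<lambda>_. euclidean" UNIV S]
    by (simp add: euclidean_product_topology S_def)
  moreover have "closed K"
    unfolding K_def l1_norm_def
    by (intro closed_Int closed closed_Collect_eq continuous_intros continuous_on_id)
  moreover have "K \<subseteq> PiE UNIV S"
  proof
    fix p assume p: "p \<in> K"
    have "cmod (p k) \<le> 1" if "k \<in> \<Lambda>" for k
      using p member_le_sum[OF that, of "\<lambda>k. cmod (p k)"] fin by (simp add: K_def l1_norm_def)
    then show "p \<in> PiE UNIV S"
      using p supp by (auto simp: K_def S_def)
  qed
  ultimately have K: "compact K"
    using compact_Int_closed[of "PiE UNIV S" K] by (simp add: Int_absorb1)
  have nz: "0 < l1_norm \<Lambda> p" if p: "p \<in> C" "p \<noteq> (\<lambda>_. 0)" for p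
  proof -
    obtain k where k: "p k \<noteq> 0"
      using p(2) by (auto simp: fun_eq_iff)
    then have "k \<in> \<Lambda>"
      using supp p(1) by blast
    then have "cmod (p k) \<le> l1_norm \<Lambda> p"
      unfolding l1_norm_def using fin by (intro member_le_sum) auto
    with k show ?thesis
      by (simp add: order_less_le_trans[of 0 "cmod (p k)"])
  qed
  have normalize: "(\<lambda>k. complex_of_real (1 / l1_norm \<Lambda> p) * p k) \<in> K" if "p \<in> C" "p \<noteq> (\<lambda>_. 0)" for p
    using scale[OF that(1), of "1 / l1_norm \<Lambda> p"] nz[OF that] l1_norm_scale[of \<Lambda> "1 / l1_norm \<Lambda> p" p]
    by (simp add: K_def)
  obtain m where m: "0 < m" "\<And>q. q \<in> K \<Longrightarrow> m \<le> F q"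
  proof (cases "K = {}")
    \<comment> \<open>\<open>K\<close> is empty only if \<open>C\<close> contains no nonzero
      sequence; any positive constant then serves.\<close>
    case True
    then show ?thesis
      using that[of 1] by auto
  next
    case False
    then obtain p where p: "p \<in> K" "\<And>q. q \<in> K \<Longrightarrow> F p \<le> F q"
      using continuous_attains_inf[OF K False continuous_on_subset[OF cont subset_UNIV]] by blast
    have "p \<noteq> (\<lambda>_. 0)"
      using p(1) by (auto simp: K_def l1_norm_def)
    then have "0 < F p"
      using p(1) pos by (simp add: K_def)
    then show ?thesis
      using that p(2) by blast
  qed
  show thesis
  proof (rule that[OF m(1)])
    fix p assume p: "p \<in> C"
    show "m * l1_norm \<Lambda> p ^ r \<le> F p"
    proof (cases "p = (\<lambda>_. 0)")
      case True
      then show ?thesis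
        using zero by (simp add: l1_norm_def zero_power)
    next
      case False
      have "m \<le> F (\<lambda>k. complex_of_real (1 / l1_norm \<Lambda> p) * p k)"
        using m(2) normalize[OF p False] by blast
      also have "\<dots> = (1 / l1_norm \<Lambda> p) ^ r * F p"
        using nz[OF p False] by (intro hom) simp
      finally show ?thesis
        using nz[OF p False] by (simp add: field_simps)
    qed
  qed
qed

section \<open>Analytic continuation and positivity of means\<close>

text \<open>On the line from \<open>\<theta>\<^sub>0\<close> to \<open>\<theta>\<close> the
  polynomial extends to an entire function of a complex parameter. It vanishes for small real
  parameters, hence everywhere by the identity theorem, and the parameter \<open>1\<close> gives
  \<open>\<theta>\<close>.\<close>

lemma trig_poly_eq_0_of_open:
  fixes p :: "int ^ 'd \<Rightarrow> complex"
  assumes fin: "finite \<Lambda>" and U: "open U" "\<theta>\<^sub>0 \<in> U" and zero: "\<And>\<theta>. \<theta> \<in> U \<Longrightarrow> trig_poly \<Lambda> p \<theta> = 0"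
  shows "trig_poly \<Lambda> p \<theta> = 0"
proof -
  define v where "v = \<theta> - \<theta>\<^sub>0"
  define ip where "ip k x = (\<Sum>j\<in>UNIV. of_int (k $ j) * x $ j)" for k :: "int ^ 'd" and x :: "real ^ 'd"
  define g where "g t = (\<Sum>k\<in>\<Lambda>. p k * exp (- \<i> * (of_real (ip k \<theta>\<^sub>0) + t * of_real (ip k v))))" for t
  have "ip k (\<theta>\<^sub>0 + t *\<^sub>R v) = ip k \<theta>\<^sub>0 + t * ip k v" for k t
    by (simp add: ip_def distrib_left sum.distrib sum_distrib_left mult_ac)
  then have g: "g (of_real t) = trig_poly \<Lambda> p (\<theta>\<^sub>0 + t *\<^sub>R v)" for t
    unfolding g_def trig_poly_def ip_def[symmetric] by simp
  have "((\<lambda>t. \<theta>\<^sub>0 + t *\<^sub>R v) \<longlongrightarrow> \<theta>\<^sub>0 + 0 *\<^sub>R v) (nhds 0)"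
    by (intro tendsto_intros filterlim_ident)
  then have "\<forall>\<^sub>F t in nhds 0. \<theta>\<^sub>0 + t *\<^sub>R v \<in> U"
    using U by (simp add: topological_tendstoD)
  then obtain d where d: "0 < d" "\<And>t. \<bar>t\<bar> < d \<Longrightarrow> \<theta>\<^sub>0 + t *\<^sub>R v \<in> U"
    unfolding eventually_nhds_metric by (auto simp: dist_real_def)
  have "g 1 = 0"
  proof (rule analytic_continuation[of g UNIV "of_real ` {-d<..<d}" 0])
    show "g holomorphic_on UNIV"
      unfolding g_def by (intro holomorphic_intros)
    show "(0 :: complex) islimpt of_real ` {-d<..<d}"
      unfolding islimpt_approachable
    proof (intro allI impI)
      fix e :: real assume "0 < e"
      then have "min d e / 2 \<in> {-d<..<d}" "0 < min d e / 2" "min d e / 2 < e"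
        using d(1) by auto
      then show "\<exists>x'\<in>complex_of_real ` {-d<..<d}. x' \<noteq> 0 \<and> dist x' 0 < e"
        by (intro bexI[OF _ imageI[of "min d e / 2"]]) (simp_all add: dist_norm del: of_real_divide)
    qed
    show "g z = 0" if "z \<in> of_real ` {-d<..<d}" for z
      using that d zero by (auto simp: g)
  qed auto
  then show ?thesis
    using g[of 1] by (simp add: v_def)
qed

text \<open>By continuity \<open>f\<close> exceeds half of its value at \<open>\<theta>\<close> on a
  ball around \<open>\<theta>\<close>. The open box leaves room for such a ball inside the torus,
  which is not open itself.\<close>

lemma torus_mean_pos:
  fixes f :: "real ^ 'd \<Rightarrow> real"
  assumes cont: "continuous_on UNIV f" and nonneg: "\<And>\<theta>. 0 \<le> f \<theta>"
    and \<theta>: "\<theta> \<in> box (\<chi> j. - pi) (\<chi> j. pi)" "0 < f \<theta>"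
  shows "0 < torus_mean f"
proof -
  interpret finite_measure "torus_measure :: (real ^ 'd) measure"
    by (rule finite_torus_measure)
  have "open (box (\<chi> j. - pi) (\<chi> j. pi) \<inter> {x. f \<theta> / 2 < f x})"
    by (intro open_Int open_box open_Collect_less continuous_intros cont)
  moreover have "\<theta> \<in> box (\<chi> j. - pi) (\<chi> j. pi) \<inter> {x. f \<theta> / 2 < f x}"
    using \<theta> by auto
  ultimately obtain r where r: "0 < r" "ball \<theta> r \<subseteq> box (\<chi> j. - pi) (\<chi> j. pi) \<inter> {x. f \<theta> / 2 < f x}"
    using openE by blast
  have sub: "ball \<theta> r \<subseteq> torus"
    using r torus_box(1) by blast
  then have sets: "ball \<theta> r \<in> sets torus_measure"
    by (auto simp: sets_restrict_space image_iff)
  have "measure torus_measure (ball \<theta> r) = measure lborel (ball \<theta> r)"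
    using sub by (simp add: measure_def emeasure_restrict_space)
  then have mpos: "0 < measure torus_measure (ball \<theta> r)"
    using content_ball_pos[OF r(1), of \<theta>] by simp
  have "0 < f \<theta> / 2 * measure torus_measure (ball \<theta> r)"
    using \<theta>(2) mpos by simp
  also have "\<dots> = integral\<^sup>L torus_measure (\<lambda>x. f \<theta> / 2 * indicator (ball \<theta> r) x)"
    using sub by (simp add: Int_absorb2)
  also have "\<dots> \<le> integral\<^sup>L torus_measure f"
  proof (intro Bochner_Integration.integral_mono)
    show "integrable torus_measure (\<lambda>x. f \<theta> / 2 * indicator (ball \<theta> r) x)"
      using sets by (intro integrable_mult_right integrable_real_indicator) (simp_all add: less_top[symmetric])
    show "f \<theta> / 2 * indicator (ball \<theta> r) x \<le> f x" for x
      using r(2) nonneg[of x] by (cases "x \<in> ball \<theta> r") (auto simp: subset_iff less_imp_le simp del: mem_ball)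
  qed (rule integrable_torus[OF cont])
  finally show ?thesis
    by (simp add: torus_mean_def)
qed

section \<open>Values of real trigonometric polynomials\<close>

locale symmetric_index_set =
  fixes \<Lambda> :: "(int ^ 'd) set"
  assumes finite_index: "finite \<Lambda>" and zero_index: "0 \<in> \<Lambda>" and symmetric_index: "uminus ` \<Lambda> = \<Lambda>"
begin

abbreviation val :: "(int ^ 'd \<Rightarrow> complex) \<Rightarrow> real ^ 'd \<Rightarrow> real" where
  "val p \<theta> \<equiv> Re (trig_poly \<Lambda> p \<theta>)"

abbreviation norm1 :: "(int ^ 'd \<Rightarrow> complex) \<Rightarrow> real" where
  "norm1 \<equiv> l1_norm \<Lambda>"

text \<open>A crude common Lipschitz constant, for the coordinatewise distance of
  \<open>near\<close>, of all exponentials with frequencies in \<open>\<Lambda>\<close>.\<close>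

definition max_freq :: real where
  "max_freq = (\<Sum>k\<in>\<Lambda>. \<Sum>j\<in>UNIV. \<bar>of_int (k $ j)\<bar>)"

lemma max_freq_nonneg: "0 \<le> max_freq"
  by (simp add: max_freq_def sum_nonneg)

lemma val_lin_comb: "val (lin_comb a p b q) \<theta> = a * val p \<theta> + b * val q \<theta>"
proof -
  have "trig_poly \<Lambda> (lin_comb a p b q) \<theta> = of_real a * trig_poly \<Lambda> p \<theta> + of_real b * trig_poly \<Lambda> q \<theta>"
    by (simp add: trig_poly_def lin_comb_def sum_distrib_left distrib_right sum.distrib mult.assoc)
  then show ?thesis
    by simp
qed

lemma val_unit: "val unit_seq \<theta> = 1"
proof -
  have "trig_poly \<Lambda> unit_seq \<theta> = (\<Sum>k\<in>\<Lambda>. if k = 0 then 1 else 0)"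
    unfolding trig_poly_def unit_seq_def by (intro sum.cong) auto
  then show ?thesis
    using finite_index zero_index by simp
qed

lemma pairing_lin_comb:
  "Re (pairing \<Lambda> c (lin_comb a p b q)) = a * Re (pairing \<Lambda> c p) + b * Re (pairing \<Lambda> c q)"
proof -
  have "pairing \<Lambda> c (lin_comb a p b q) = of_real a * pairing \<Lambda> c p + of_real b * pairing \<Lambda> c q"
    by (simp add: pairing_def lin_comb_def sum_distrib_left distrib_left sum.distrib mult_ac)
  then show ?thesis
    by simp
qed

lemma hermitian_lin_comb:
  assumes "p \<in> hermitian_seqs \<Lambda>" "q \<in> hermitian_seqs \<Lambda>"
  shows "lin_comb a p b q \<in> hermitian_seqs \<Lambda>"
  using assms by (simp add: hermitian_seqs_def lin_comb_def)

lemma hermitian_unit: "unit_seq \<in> hermitian_seqs \<Lambda>"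
  using zero_index by (auto simp: hermitian_seqs_def unit_seq_def)

lemma norm1_unit: "norm1 unit_seq = 1"
proof -
  have "norm1 unit_seq = (\<Sum>k\<in>\<Lambda>. if k = 0 then 1 else 0)"
    unfolding l1_norm_def unit_seq_def by (intro sum.cong) auto
  then show ?thesis
    using finite_index zero_index by simp
qed

lemma trig_poly_eq_val:
  "p \<in> hermitian_seqs \<Lambda> \<Longrightarrow> trig_poly \<Lambda> p \<theta> = complex_of_real (val p \<theta>)"
  using trig_poly_real[OF symmetric_index] by simp

lemma norm_exp_phase [simp]: "cmod (exp (- (\<i> * complex_of_real x))) = 1"
  by (simp add: norm_exp_eq_Re)

lemma val_bound: "\<bar>val p \<theta>\<bar> \<le> norm1 p"
proof -
  have "\<bar>val p \<theta>\<bar> \<le> cmod (trig_poly \<Lambda> p \<theta>)"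
    by (rule abs_Re_le_cmod)
  also have "\<dots> \<le> norm1 p"
    unfolding trig_poly_def l1_norm_def by (intro sum_norm_le) (simp add: norm_mult)
  finally show ?thesis .
qed

lemma val_continuous [continuous_intros]:
  assumes "continuous_on S f"
  shows "continuous_on S (\<lambda>x. val p (f x))"
proof -
  have "continuous_on UNIV (\<lambda>\<theta>. val p \<theta>)"
    unfolding trig_poly_def by (intro continuous_intros)
  then show ?thesis
    using assms continuous_on_compose2 by blast
qed

lemma val_continuous_coeff [continuous_intros]: "continuous_on S (\<lambda>p. val p \<theta>)"
  unfolding trig_poly_def by (intro continuous_intros continuous_on_id)

lemma val_periodic: "periodic (val p)"
  unfolding periodic_def
proof (intro allI)
  fix x :: "real ^ 'd" and z :: "int ^ 'd"
  let ?y = "x + (\<chi> j. 2 * pi * of_int (z $ j))"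
  have "exp (- \<i> * complex_of_real (\<Sum>j\<in>UNIV. of_int (k $ j) * ?y $ j)) =
      exp (- \<i> * complex_of_real (\<Sum>j\<in>UNIV. of_int (k $ j) * x $ j))" for k :: "int ^ 'd"
  proof -
    have "(\<Sum>j\<in>UNIV. of_int (k $ j) * ?y $ j) =
        (\<Sum>j\<in>UNIV. of_int (k $ j) * x $ j) + 2 * pi * of_int (\<Sum>j\<in>UNIV. k $ j * z $ j)"
      by (simp add: distrib_left sum.distrib sum_distrib_left mult_ac)
    then have "- \<i> * complex_of_real (\<Sum>j\<in>UNIV. of_int (k $ j) * ?y $ j) =
        - \<i> * complex_of_real (\<Sum>j\<in>UNIV. of_int (k $ j) * x $ j) +
        of_int (2 * (- (\<Sum>j\<in>UNIV. k $ j * z $ j))) * pi * \<i>"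
      by (simp add: algebra_simps)
    then show ?thesis
      unfolding exp_eq by blast
  qed
  then show "val p ?y = val p x"
    unfolding trig_poly_def by presburger
qed

text \<open>Each exponential is Lipschitz, since the chord \<open>cmod (cis a - cis b)\<close>
  equals \<open>2 * \<bar>sin ((a - b) / 2)\<bar>\<close>. The factor \<open>norm1 p\<close> makes
  all polynomials with bounded coefficients equicontinuous.\<close>

lemma val_osc:
  assumes "near h x y"
  shows "\<bar>val p x - val p y\<bar> \<le> norm1 p * (max_freq * h)"
proof -
  let ?ip = "\<lambda>k x. \<Sum>j\<in>UNIV. of_int (k $ j) * x $ j"
  let ?e = "\<lambda>k x. exp (- \<i> * complex_of_real (?ip k x))"
  have h: "0 \<le> h"
    using assms unfolding near_def by (meson abs_ge_zero order_trans)
  have e: "cmod (?e k x - ?e k y) \<le> max_freq * h" if "k \<in> \<Lambda>" for k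
  proof -
    have "cmod (?e k x - ?e k y) \<le> \<bar>?ip k x - ?ip k y\<bar>"
    proof -
      have "?e k x = cis (- ?ip k x)" "?e k y = cis (- ?ip k y)"
        by (simp_all add: cis_conv_exp)
      moreover have "cmod (cis a - cis b) \<le> \<bar>a - b\<bar>" for a b :: real
      proof -
        have "cis a - cis b = cis b * (cis (a - b) - 1)"
          by (simp add: right_diff_distrib cis_mult)
        then have "cmod (cis a - cis b) = cmod (cis (a - b) - 1)"
          by (simp add: norm_mult)
        also have "\<dots> = cmod (exp (\<i> * of_real (a - b)) - 1)"
          by (simp add: cis_conv_exp)
        also have "\<dots> = 2 * \<bar>sin ((a - b) / 2)\<bar>"
          using dist_exp_i_1 by blast
        also have "\<dots> \<le> \<bar>a - b\<bar>"
          using abs_sin_x_le_abs_x[of "(a - b) / 2"] by simp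
        finally show ?thesis .
      qed
      ultimately show ?thesis
        by (smt (verit))
    qed
    also have "?ip k x - ?ip k y = (\<Sum>j\<in>UNIV. of_int (k $ j) * (x $ j - y $ j))"
      by (simp add: right_diff_distrib sum_subtractf)
    also have "\<bar>\<dots>\<bar> \<le> (\<Sum>j\<in>UNIV. \<bar>of_int (k $ j) * (x $ j - y $ j)\<bar>)"
      by (rule sum_abs)
    also have "\<dots> \<le> (\<Sum>j\<in>UNIV. \<bar>of_int (k $ j)\<bar> * h)"
      using assms by (intro sum_mono) (auto simp: near_def abs_mult intro!: mult_left_mono)
    also have "\<dots> = (\<Sum>j\<in>UNIV. \<bar>of_int (k $ j)\<bar>) * h"
      by (simp add: sum_distrib_right)
    also have "\<dots> \<le> max_freq * h"
      unfolding max_freq_def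
      by (intro mult_right_mono h member_le_sum[OF that] finite_index sum_nonneg) auto
    finally show ?thesis .
  qed
  have "val p x - val p y = Re (\<Sum>k\<in>\<Lambda>. p k * (?e k x - ?e k y))"
    by (simp only: trig_poly_def right_diff_distrib sum_subtractf minus_complex.sel)
  then have "\<bar>val p x - val p y\<bar> \<le> cmod (\<Sum>k\<in>\<Lambda>. p k * (?e k x - ?e k y))"
    by (simp only: abs_Re_le_cmod)
  also have "\<dots> \<le> (\<Sum>k\<in>\<Lambda>. cmod (p k) * (max_freq * h))"
    using e by (intro sum_norm_le) (simp add: norm_mult mult_left_mono)
  also have "\<dots> = norm1 p * (max_freq * h)"
    by (simp add: l1_norm_def sum_distrib_right)
  finally show ?thesis .
qed

section \<open>Positive cones and their closures\<close>

lemma pos_cone_iff: "p \<in> pos_cone \<Lambda> \<longleftrightarrow> p \<in> hermitian_seqs \<Lambda> \<and> (\<forall>\<theta>. 0 < val p \<theta>)"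
proof -
  have ex: "\<exists>y\<in>torus. val p \<theta> = val p y" for \<theta>
  proof -
    \<comment> \<open>The ceiling matches the torus, which is open at \<open>- pi\<close> and closed
      at \<open>pi\<close>.\<close>
    define z where "z j = \<lceil>(\<theta> $ j - pi) / (2 * pi)\<rceil>" for j
    define y where "y = (\<chi> j. \<theta> $ j - 2 * pi * of_int (z j))"
    have "- pi < y $ j \<and> y $ j \<le> pi" for j
    proof -
      have "of_int (z j) - 1 < (\<theta> $ j - pi) / (2 * pi)" "(\<theta> $ j - pi) / (2 * pi) \<le> of_int (z j)"
        unfolding z_def by linarith+
      then show ?thesis
        by (simp add: y_def field_simps)
    qed
    then have "y \<in> torus"
      by (simp add: torus_def)
    moreover have "val p \<theta> = val p y"
      by (rule periodic_cong[OF val_periodic]) (auto simp: y_def)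
    ultimately show ?thesis
      by blast
  qed
  have "(\<forall>\<theta>\<in>torus. 0 < val p \<theta>) \<longleftrightarrow> (\<forall>\<theta>. 0 < val p \<theta>)"
  proof (intro iffI allI)
    fix \<theta> assume pos: "\<forall>\<theta>\<in>torus. 0 < val p \<theta>"
    obtain y where "y \<in> torus" "val p \<theta> = val p y"
      using ex[of \<theta>] by (elim bexE)
    then show "0 < val p \<theta>"
      using pos by simp
  qed simp
  then show ?thesis
    unfolding pos_cone_def by simp
qed

lemma closed_hermitian: "closed (hermitian_seqs \<Lambda>)"
proof -
  have "hermitian_seqs \<Lambda> = {p. \<forall>k. (k \<notin> \<Lambda> \<longrightarrow> p k = 0) \<and> (k \<in> \<Lambda> \<longrightarrow> p (- k) = cnj (p k))}"
    by (auto simp: hermitian_seqs_def)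
  also have "closed \<dots>"
    by (intro closed_Collect_all closed_Collect_conj closed_Collect_imp open_Collect_const
        closed_Collect_eq continuous_intros continuous_on_id)
  finally show ?thesis .
qed

text \<open>Nonnegativity is a closed condition. Conversely, a nonnegative \<open>p\<close> becomes
  strictly positive when shifted by any \<open>e > 0\<close>, and the shifted polynomials tend to
  \<open>p\<close> as \<open>e\<close> tends to \<open>0\<close>.\<close>

lemma closure_pos_cone: "closure (pos_cone \<Lambda>) = {p \<in> hermitian_seqs \<Lambda>. \<forall>\<theta>. 0 \<le> val p \<theta>}"
proof
  have "closed (hermitian_seqs \<Lambda> \<inter> {p. \<forall>\<theta>. 0 \<le> val p \<theta>})"
    by (intro closed_Int closed_hermitian closed_Collect_all closed_Collect_le continuous_intros)
  moreover have "hermitian_seqs \<Lambda> \<inter> {p. \<forall>\<theta>. 0 \<le> val p \<theta>} = {p \<in> hermitian_seqs \<Lambda>. \<forall>\<theta>. 0 \<le> val p \<theta>}"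
    by auto
  ultimately show "closure (pos_cone \<Lambda>) \<subseteq> {p \<in> hermitian_seqs \<Lambda>. \<forall>\<theta>. 0 \<le> val p \<theta>}"
    by (intro closure_minimal) (auto simp: pos_cone_iff less_imp_le)
  show "{p \<in> hermitian_seqs \<Lambda>. \<forall>\<theta>. 0 \<le> val p \<theta>} \<subseteq> closure (pos_cone \<Lambda>)"
  proof
    fix p assume p: "p \<in> {p \<in> hermitian_seqs \<Lambda>. \<forall>\<theta>. 0 \<le> val p \<theta>}"
    have "continuous_on (closure {0<..}) (\<lambda>e. lin_comb 1 p e unit_seq)"
      unfolding lin_comb_def by (intro continuous_on_coordinatewise_then_product continuous_intros)
    moreover have "(\<lambda>e. lin_comb 1 p e unit_seq) ` {0<..} \<subseteq> closure (pos_cone \<Lambda>)"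
      using p by (intro order_trans[OF _ closure_subset])
        (auto simp: pos_cone_iff hermitian_lin_comb hermitian_unit val_lin_comb val_unit add_nonneg_pos)
    ultimately have "(\<lambda>e. lin_comb 1 p e unit_seq) ` closure {0<..} \<subseteq> closure (pos_cone \<Lambda>)"
      by (intro image_closure_subset) auto
    moreover have "lin_comb 1 p 0 unit_seq = p"
      by (simp add: lin_comb_def)
    moreover have "(0 :: real) \<in> closure {0<..}"
      by simp
    ultimately show "p \<in> closure (pos_cone \<Lambda>)"
      by (metis (no_types, lifting) image_subset_iff)
  qed
qed

lemma closure_pos_cone_grid:
  assumes "p \<in> closure (pos_cone_grid \<Lambda> N)"
  shows "p \<in> hermitian_seqs \<Lambda>" "\<And>l. l \<in> grid N \<Longrightarrow> 0 \<le> val p (grid_angle N l)"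
proof -
  have "closed (hermitian_seqs \<Lambda> \<inter> {p. \<forall>l. l \<in> grid N \<longrightarrow> 0 \<le> val p (grid_angle N l)})"
    by (intro closed_Int closed_hermitian closed_Collect_all closed_Collect_imp open_Collect_const
        closed_Collect_le continuous_intros)
  then have "closure (pos_cone_grid \<Lambda> N) \<subseteq>
      hermitian_seqs \<Lambda> \<inter> {p. \<forall>l. l \<in> grid N \<longrightarrow> 0 \<le> val p (grid_angle N l)}"
    by (intro closure_minimal) (auto simp: pos_cone_grid_def less_imp_le)
  then show "p \<in> hermitian_seqs \<Lambda>" "\<And>l. l \<in> grid N \<Longrightarrow> 0 \<le> val p (grid_angle N l)"
    using assms by auto
qed

section \<open>Coercivity of the pairing and of the weighted square\<close>

lemma scale_eq_lin_comb: "(\<lambda>k. complex_of_real t * p k) = lin_comb t p 0 p"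
  by (simp add: lin_comb_def)

lemma dual_cone_coercive:
  assumes "c \<in> dual_cone \<Lambda>"
  obtains \<alpha> where "0 < \<alpha>" "\<And>q. q \<in> closure (pos_cone \<Lambda>) \<Longrightarrow> \<alpha> * norm1 q \<le> Re (pairing \<Lambda> c q)"
proof -
  have "\<exists>\<alpha>>0. \<forall>q\<in>closure (pos_cone \<Lambda>). \<alpha> * norm1 q ^ 1 \<le> Re (pairing \<Lambda> c q)"
  proof (rule homogeneous_lower_bound[OF finite_index closed_closure, of "pos_cone \<Lambda>" "\<lambda>q. Re (pairing \<Lambda> c q)" 1])
    show "p k = 0" if "p \<in> closure (pos_cone \<Lambda>)" "k \<notin> \<Lambda>" for p k
      using that by (simp add: closure_pos_cone hermitian_seqs_def)
    show "(\<lambda>k. complex_of_real t * p k) \<in> closure (pos_cone \<Lambda>)" if "p \<in> closure (pos_cone \<Lambda>)" "0 < t" for p t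
      using that by (simp add: scale_eq_lin_comb[of t p] closure_pos_cone hermitian_lin_comb val_lin_comb)
    show "continuous_on UNIV (\<lambda>q. Re (pairing \<Lambda> c q))"
      unfolding pairing_def by (intro continuous_intros continuous_on_id)
    show "Re (pairing \<Lambda> c (\<lambda>k. complex_of_real t * p k)) = t ^ 1 * Re (pairing \<Lambda> c p)" for p t
      by (simp add: scale_eq_lin_comb[of t p] pairing_lin_comb)
    show "0 < Re (pairing \<Lambda> c p)" if "p \<in> closure (pos_cone \<Lambda>)" "p \<noteq> (\<lambda>_. 0)" for p
      using assms that by (simp add: dual_cone_def)
  qed (auto simp: pairing_def)
  then show thesis
    using that by auto
qed

text \<open>If \<open>p\<close> is the zero function, both \<open>p\<close> and \<open>- p\<close> lie in the closed cone, and \<open>c\<close> cannot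
  pair positively with both.\<close>

lemma hermitian_eq_0_of_val:
  assumes "c \<in> dual_cone \<Lambda>" "p \<in> hermitian_seqs \<Lambda>" "\<And>\<theta>. val p \<theta> = 0"
  shows "p = (\<lambda>_. 0)"
proof (rule ccontr)
  assume nz: "p \<noteq> (\<lambda>_. 0)"
  then have "lin_comb (-1) p 0 p \<noteq> (\<lambda>_. 0)"
    by (auto simp: lin_comb_def fun_eq_iff)
  moreover have "p \<in> closure (pos_cone \<Lambda>)" "lin_comb (-1) p 0 p \<in> closure (pos_cone \<Lambda>)"
    using assms by (simp_all add: closure_pos_cone hermitian_lin_comb val_lin_comb)
  ultimately have "0 < Re (pairing \<Lambda> c p)" "0 < Re (pairing \<Lambda> c (lin_comb (-1) p 0 p))"
    using assms(1) nz unfolding dual_cone_def by blast+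
  then show False
    by (simp add: pairing_lin_comb)
qed

lemma val_nonzero_in_open:
  assumes "c \<in> dual_cone \<Lambda>" "p \<in> hermitian_seqs \<Lambda>" "p \<noteq> (\<lambda>_. 0)" "open U" "U \<noteq> {}"
  shows "\<exists>\<theta>\<in>U. val p \<theta> \<noteq> 0"
proof (rule ccontr)
  assume "\<not> ?thesis"
  then have "val p \<theta> = 0" if "\<theta> \<in> U" for \<theta>
    using that by blast
  then have "trig_poly \<Lambda> p \<theta> = 0" if "\<theta> \<in> U" for \<theta>
    using that by (subst trig_poly_eq_val[OF assms(2)]) simp
  then have "trig_poly \<Lambda> p \<theta> = 0" for \<theta>
    using trig_poly_eq_0_of_open[OF finite_index assms(4)] assms(5) by blast
  then show False
    using hermitian_eq_0_of_val[OF assms(1,2)] assms(3) by simp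
qed

text \<open>\<open>P\<close> is nonzero at some point of the open box, hence on a neighbourhood of
  it, and \<open>D\<close> cannot vanish throughout that neighbourhood. So the nonnegative integrand
  is positive somewhere in the box.\<close>

lemma weighted_square_pos:
  assumes c: "c \<in> dual_cone \<Lambda>" and P: "P \<in> closure (pos_cone \<Lambda>)" "P \<noteq> (\<lambda>_. 0)"
    and D: "D \<in> hermitian_seqs \<Lambda>" "D \<noteq> (\<lambda>_. 0)"
  shows "0 < torus_mean (\<lambda>\<theta>. val P \<theta> * (val D \<theta>)\<^sup>2)"
proof -
  let ?B = "box (\<chi> j. - pi) (\<chi> j. pi) :: (real ^ 'd) set"
  have PH: "P \<in> hermitian_seqs \<Lambda>" and Pn: "\<And>\<theta>. 0 \<le> val P \<theta>"
    using P(1) by (simp_all add: closure_pos_cone)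
  have "0 \<in> ?B"
    by (simp add: mem_box_cart)
  then obtain \<theta>\<^sub>1 where "\<theta>\<^sub>1 \<in> ?B" "val P \<theta>\<^sub>1 \<noteq> 0"
    using val_nonzero_in_open[OF c PH P(2) open_box] by blast
  then have "?B \<inter> {\<theta>. val P \<theta> \<noteq> 0} \<noteq> {}"
    by blast
  moreover have "open (?B \<inter> {\<theta>. val P \<theta> \<noteq> 0})"
    by (intro open_Int open_box open_Collect_neq continuous_intros continuous_on_id)
  ultimately obtain \<theta> where "\<theta> \<in> ?B" "val P \<theta> \<noteq> 0" "val D \<theta> \<noteq> 0"
    using val_nonzero_in_open[OF c D] by blast
  then show ?thesis
    using Pn by (intro torus_mean_pos[of _ \<theta>] continuous_intros continuous_on_id) (auto simp: order_less_le)
qed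

text \<open>Expanding the mean as a quadratic form with coefficients \<open>I k l\<close> makes its
  continuity and homogeneity in \<open>D\<close> evident. With positivity on nonzero Hermitian
  sequences, the compactness argument for degree two applies.\<close>

lemma weighted_square_coercive:
  assumes c: "c \<in> dual_cone \<Lambda>" and P: "P \<in> closure (pos_cone \<Lambda>)" "P \<noteq> (\<lambda>_. 0)"
  obtains \<kappa> where "0 < \<kappa>"
    "\<And>D. D \<in> hermitian_seqs \<Lambda> \<Longrightarrow> \<kappa> * (norm1 D)\<^sup>2 \<le> torus_mean (\<lambda>\<theta>. val P \<theta> * (val D \<theta>)\<^sup>2)"
proof -
  define e where "e k \<theta> = exp (- \<i> * complex_of_real (\<Sum>j\<in>UNIV. of_int (k $ j) * \<theta> $ j))"
    for k :: "int ^ 'd" and \<theta> :: "real ^ 'd"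
  define I where "I k l = integral\<^sup>L torus_measure (\<lambda>\<theta>. complex_of_real (val P \<theta>) * e k \<theta> * e l \<theta>)" for k l
  \<comment> \<open>\<open>F D\<close> is the real part of the mean of \<open>val P\<close> times
    the complex square of the polynomial; for Hermitian \<open>D\<close> the values are real and
    this square is \<open>(val D \<theta>)\<^sup>2\<close>.\<close>
  define F where "F D = (1 / (2 * pi)) ^ CARD('d) * Re (\<Sum>k\<in>\<Lambda>. \<Sum>l\<in>\<Lambda>. D k * D l * I k l)"
    for D :: "int ^ 'd \<Rightarrow> complex"
  have eq: "F D = torus_mean (\<lambda>\<theta>. val P \<theta> * (val D \<theta>)\<^sup>2)" if "D \<in> hermitian_seqs \<Lambda>" for D
  proof -
    have cont: "continuous_on UNIV (\<lambda>\<theta>. complex_of_real (val P \<theta>) * e k \<theta> * e l \<theta>)" for k l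
      unfolding e_def by (intro continuous_intros continuous_on_id)
    have "complex_of_real (val P \<theta> * (val D \<theta>)\<^sup>2) =
        (\<Sum>k\<in>\<Lambda>. \<Sum>l\<in>\<Lambda>. D k * D l * (complex_of_real (val P \<theta>) * e k \<theta> * e l \<theta>))" for \<theta>
    proof -
      have "complex_of_real (val P \<theta> * (val D \<theta>)\<^sup>2) =
          complex_of_real (val P \<theta>) * (trig_poly \<Lambda> D \<theta> * trig_poly \<Lambda> D \<theta>)"
        unfolding of_real_mult power2_eq_square trig_poly_eq_val[OF that, symmetric] ..
      also have "trig_poly \<Lambda> D \<theta> * trig_poly \<Lambda> D \<theta> =
          (\<Sum>k\<in>\<Lambda>. \<Sum>l\<in>\<Lambda>. (D k * e k \<theta>) * (D l * e l \<theta>))"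
        by (simp only: trig_poly_def e_def sum_product)
      also have "complex_of_real (val P \<theta>) * \<dots> =
          (\<Sum>k\<in>\<Lambda>. \<Sum>l\<in>\<Lambda>. D k * D l * (complex_of_real (val P \<theta>) * e k \<theta> * e l \<theta>))"
        by (simp only: sum_distrib_left mult_ac)
      finally show ?thesis .
    qed
    then have "integral\<^sup>L torus_measure (\<lambda>\<theta>. complex_of_real (val P \<theta> * (val D \<theta>)\<^sup>2)) =
        integral\<^sup>L torus_measure (\<lambda>\<theta>. \<Sum>k\<in>\<Lambda>. \<Sum>l\<in>\<Lambda>. D k * D l * (complex_of_real (val P \<theta>) * e k \<theta> * e l \<theta>))"
      by (simp only:)
    also have "\<dots> = (\<Sum>k\<in>\<Lambda>. \<Sum>l\<in>\<Lambda>. D k * D l * I k l)"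
      unfolding I_def
      by (simp add: Bochner_Integration.integral_sum Bochner_Integration.integrable_sum
          integrable_mult_right integrable_torus cont del: of_real_mult)
    finally have "(\<Sum>k\<in>\<Lambda>. \<Sum>l\<in>\<Lambda>. D k * D l * I k l) =
        complex_of_real (integral\<^sup>L torus_measure (\<lambda>\<theta>. val P \<theta> * (val D \<theta>)\<^sup>2))"
      by (simp only: integral_complex_of_real)
    then show ?thesis
      by (simp add: F_def torus_mean_def)
  qed
  have "\<exists>\<kappa>>0. \<forall>D\<in>hermitian_seqs \<Lambda>. \<kappa> * norm1 D ^ 2 \<le> F D"
  proof (rule homogeneous_lower_bound[OF finite_index closed_hermitian, of F 2])
    show "D k = 0" if "D \<in> hermitian_seqs \<Lambda>" "k \<notin> \<Lambda>" for D k
      using that by (simp add: hermitian_seqs_def)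
    show "(\<lambda>k. complex_of_real t * D k) \<in> hermitian_seqs \<Lambda>" if "D \<in> hermitian_seqs \<Lambda>" for D t
      using that by (simp add: scale_eq_lin_comb[of t D] hermitian_lin_comb)
    show "continuous_on UNIV F"
      unfolding F_def by (intro continuous_intros continuous_on_id)
    show "F (\<lambda>k. complex_of_real t * D k) = t ^ 2 * F D" for D t
    proof -
      have "(\<Sum>k\<in>\<Lambda>. \<Sum>l\<in>\<Lambda>. (complex_of_real t * D k) * (complex_of_real t * D l) * I k l) =
          complex_of_real (t ^ 2) * (\<Sum>k\<in>\<Lambda>. \<Sum>l\<in>\<Lambda>. D k * D l * I k l)"
        by (simp add: sum_distrib_left power2_eq_square mult_ac)
      then show ?thesis
        unfolding F_def by simp
    qed
    show "0 < F D" if "D \<in> hermitian_seqs \<Lambda>" "D \<noteq> (\<lambda>_. 0)" for D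
      using weighted_square_pos[OF c P that] eq[OF that(1)] by simp
  qed (auto simp: F_def)
  then show thesis
    using that eq by auto
qed

end

section \<open>Comparison of the minimizers\<close>

lemma mult_log_pos: "0 < y \<Longrightarrow> mult_log x y = ereal (x * ln y)"
  by (simp add: mult_log_def zero_ereal_def)

lemma mult_log_mono:
  assumes "0 \<le> x" "y \<le> z" "0 < z"
  shows "mult_log x y \<le> ereal (x * ln z)"
  using assms by (auto simp: mult_log_def intro!: mult_left_mono)

lemma ext_integral_ereal:
  assumes "integrable M f"
  shows "ext_integral M (\<lambda>x. ereal (f x)) = ereal (integral\<^sup>L M f)"
proof -
  have fin: "(\<integral>\<^sup>+ x. ennreal (f x) \<partial>M) < top" "(\<integral>\<^sup>+ x. ennreal (- f x) \<partial>M) < top"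
    using assms by (auto simp: real_integrable_def less_top)
  have enn: "enn2ereal a = ereal (enn2real a)" if "a < top" for a
    using that by (cases a) auto
  show ?thesis
    unfolding ext_integral_def real_lebesgue_integral_def[OF assms]
    using fin by (simp add: enn)
qed

lemma ext_integral_mono:
  assumes "\<And>x. x \<in> space M \<Longrightarrow> f x \<le> g x"
  shows "ext_integral M f \<le> ext_integral M g"
  unfolding ext_integral_def
  using assms by (intro ereal_minus_mono) (auto simp: less_eq_ennreal.rep_eq[symmetric] intro!: nn_integral_mono e2ennreal_mono)

text \<open>The bound \<open>i\<close> excludes \<open>I = \<infinity>\<close>, and
  \<open>I = - \<infinity>\<close> would make the left side of the first hypothesis infinite. Only
  finite \<open>I\<close> remains, so the comparison with a minimizer can be carried out in the
  reals.\<close>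

lemma ereal_minus_mult_le:
  assumes "ereal a - ereal k * I \<le> ereal r" "I \<le> ereal i" "0 < k"
  shows "a - k * i \<le> r"
proof (cases I)
  case (real x)
  then have "a - k * x \<le> r" "k * x \<le> k * i"
    using assms by auto
  then show ?thesis
    by simp
qed (use assms in auto)

text \<open>Apply \<open>ln x \<le> x - 1\<close> to \<open>x = a * b / s\<^sup>2\<close> with the
  midpoint \<open>s\<close>. Since \<open>a * b = s\<^sup>2 - (a - b)\<^sup>2 / 4\<close>, the right
  side is \<open>- ((a - b)\<^sup>2 / (4 * s\<^sup>2))\<close>, and
  \<open>s \<le> R\<close>.\<close>

lemma ln_midpoint_ge:
  fixes a b R :: real
  assumes "0 < a" "0 < b" "a \<le> R" "b \<le> R"
  shows "(ln a + ln b) / 2 + (a - b)\<^sup>2 / (8 * R\<^sup>2) \<le> ln (a / 2 + b / 2)"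
proof -
  define s where "s = a / 2 + b / 2"
  have s: "0 < s" "s \<le> R"
    using assms by (auto simp: s_def)
  have "ln (a * b / s\<^sup>2) \<le> a * b / s\<^sup>2 - 1"
    using assms s by (intro ln_le_minus_one) simp
  moreover have "ln (a * b / s\<^sup>2) = ln a + ln b - 2 * ln s"
    using assms s by (simp add: ln_div ln_mult ln_realpow)
  moreover have "a * b / s\<^sup>2 - 1 = - ((a - b)\<^sup>2 / (4 * s\<^sup>2))"
  proof -
    have "a * b = s\<^sup>2 - (a - b)\<^sup>2 / 4"
      by (simp add: s_def power2_eq_square field_simps)
    then show ?thesis
      using s by (simp add: diff_divide_distrib)
  qed
  moreover have "(a - b)\<^sup>2 / (4 * R\<^sup>2) \<le> (a - b)\<^sup>2 / (4 * s\<^sup>2)"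
    using s by (intro divide_left_mono mult_left_mono power_mono) auto
  ultimately have "ln a + ln b + (a - b)\<^sup>2 / (4 * R\<^sup>2) \<le> 2 * ln s"
    by linarith
  moreover have "(a - b)\<^sup>2 / (8 * R\<^sup>2) = ((a - b)\<^sup>2 / (4 * R\<^sup>2)) / 2"
    by simp
  ultimately show ?thesis
    unfolding s_def by argo
qed

lemma ln_lipschitz:
  fixes a b \<delta> :: real
  assumes "0 < \<delta>" "\<delta> \<le> a" "\<delta> \<le> b"
  shows "\<bar>ln a - ln b\<bar> \<le> \<bar>a - b\<bar> / \<delta>"
proof -
  have "ln x - ln y \<le> \<bar>x - y\<bar> / \<delta>" if "\<delta> \<le> x" "\<delta> \<le> y" for x y
  proof -
    have "ln x - ln y \<le> (x - y) / y"
      using that assms by (intro ln_diff_le) auto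
    also have "\<dots> \<le> \<bar>x - y\<bar> / y"
      using that assms by (intro divide_right_mono) auto
    also have "\<dots> \<le> \<bar>x - y\<bar> / \<delta>"
      using that assms by (intro divide_left_mono) auto
    finally show ?thesis .
  qed
  from this[of a b] this[of b a] assms show ?thesis
    by (simp add: abs_minus_commute)
qed

lemma ln_abs_bound:
  fixes a \<delta> R :: real
  assumes "0 < \<delta>" "\<delta> \<le> a" "a \<le> R"
  shows "\<bar>ln a\<bar> \<le> 1 / \<delta> + R"
proof -
  have "ln a \<le> a - 1" "ln (1 / a) \<le> 1 / a - 1"
    using assms by (auto intro!: ln_le_minus_one)
  moreover have "ln (1 / a) = - ln a"
    using assms by (simp add: ln_div)
  moreover have "1 / a \<le> 1 / \<delta>" "0 < 1 / \<delta>"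
    using assms by (auto intro!: divide_left_mono)
  ultimately show ?thesis
    using assms by linarith
qed

text \<open>At \<open>\<delta> * (1 + x)\<close> the logarithm lies below its tangent at
  \<open>1\<close>, so \<open>n * ln (1 + x)\<close> is at most a linear function of slope
  \<open>n * \<delta>\<close>. The choice of \<open>\<delta>\<close> makes this slope at most
  \<open>a / 2\<close>; the \<open>n + 1\<close> in its denominator allows
  \<open>n = 0\<close>.\<close>

lemma sublinear_bound:
  fixes a b n :: real
  assumes "0 < a" "0 \<le> n"
  obtains R where "\<And>x. 0 \<le> x \<Longrightarrow> a * x \<le> b + n * ln (1 + x) \<Longrightarrow> x \<le> R"
proof -
  define \<delta> where "\<delta> = a / (2 * (n + 1))"
  have \<delta>: "0 < \<delta>" "n * \<delta> \<le> a / 2"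
    using assms by (auto simp: \<delta>_def field_simps)
  have "x \<le> (b + a / 2 - n * (1 + ln \<delta>)) / (a / 2)" if x: "0 \<le> x" "a * x \<le> b + n * ln (1 + x)" for x
  proof -
    have "ln (\<delta> * (1 + x)) \<le> \<delta> * (1 + x) - 1"
      using \<delta> x by (intro ln_le_minus_one) auto
    then have "ln (1 + x) \<le> \<delta> * (1 + x) - (1 + ln \<delta>)"
      using \<delta> x by (simp add: ln_mult)
    then have "n * ln (1 + x) \<le> n * (\<delta> * (1 + x) - (1 + ln \<delta>))"
      using assms by (intro mult_left_mono)
    also have "\<dots> = n * \<delta> * (1 + x) - n * (1 + ln \<delta>)"
      by (simp add: right_diff_distrib)
    also have "\<dots> \<le> a / 2 * (1 + x) - n * (1 + ln \<delta>)"
      using \<delta> x by (intro diff_right_mono mult_right_mono) auto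
    finally have "a / 2 * x \<le> b + a / 2 - n * (1 + ln \<delta>)"
      using x by (simp add: algebra_simps)
    then show ?thesis
      using assms by (simp add: field_simps)
  qed
  then show thesis
    using that by blast
qed

lemma exists_small_multiple:
  fixes K b :: real
  assumes "0 \<le> K" "0 < b"
  obtains h where "0 < h" "K * h \<le> b"
proof (rule that[of "b / (K + 1)"])
  show "0 < b / (K + 1)" "K * (b / (K + 1)) \<le> b"
    using assms by (auto simp: field_simps)
qed

lemma grid_mean_mono:
  assumes "\<And>l. l \<in> grid N \<Longrightarrow> f (grid_angle N l) \<le> g (grid_angle N l)"
  shows "grid_mean N f \<le> grid_mean N g"
  unfolding grid_mean_def using assms by (intro mult_left_mono sum_mono) (auto intro!: prod_nonneg)

lemma grid_mean_const:
  assumes "\<And>j. 0 < N $ j"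
  shows "grid_mean N (\<lambda>_. C) = C"
proof -
  have "(\<Prod>j\<in>UNIV. real (N $ j)) \<noteq> 0"
    using assms by (simp add: less_imp_neq[symmetric])
  then show ?thesis
    by (simp add: grid_mean_def card_grid)
qed

lemma grid_mean_add: "grid_mean N (\<lambda>x. f x + g x) = grid_mean N f + grid_mean N g"
  by (simp add: grid_mean_def sum.distrib distrib_left)

lemma grid_mean_mult: "grid_mean N (\<lambda>x. a * f x) = a * grid_mean N f"
  by (simp add: grid_mean_def flip: sum_distrib_left)

lemma periodic_comp2: "periodic f \<Longrightarrow> periodic g \<Longrightarrow> periodic (\<lambda>x. F (f x) (g x))"
  by (simp add: periodic_def)

lemma product_osc:
  fixes a b c d :: real
  assumes "\<bar>a - b\<bar> \<le> u" "\<bar>c\<bar> \<le> C" "\<bar>b\<bar> \<le> B" "\<bar>c - d\<bar> \<le> v"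
  shows "\<bar>a * c - b * d\<bar> \<le> u * C + B * v"
proof -
  have "a * c - b * d = (a - b) * c + b * (c - d)"
    by (simp add: algebra_simps)
  then have "\<bar>a * c - b * d\<bar> \<le> \<bar>a - b\<bar> * \<bar>c\<bar> + \<bar>b\<bar> * \<bar>c - d\<bar>"
    by (metis abs_mult abs_triangle_ineq)
  also have "\<dots> \<le> u * C + B * v"
    using assms by (intro add_mono mult_mono) auto
  finally show ?thesis .
qed

section \<open>Near-minimality of the shifted minimizers\<close>

context symmetric_index_set
begin

text \<open>For strictly positive \<open>Q\<close> the logarithm is finite everywhere and
  \<open>J_cont\<close> takes this real-valued form, to which the Riemann sum estimates
  apply.\<close>

definition J_real :: "(int ^ 'd \<Rightarrow> complex) \<Rightarrow> (int ^ 'd \<Rightarrow> complex) \<Rightarrow> (int ^ 'd \<Rightarrow> complex) \<Rightarrow> real" where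
  "J_real c P Q = Re (pairing \<Lambda> c Q) - torus_mean (\<lambda>\<theta>. val P \<theta> * ln (val Q \<theta>))"

definition J_real_grid ::
    "(int ^ 'd \<Rightarrow> complex) \<Rightarrow> (int ^ 'd \<Rightarrow> complex) \<Rightarrow> nat ^ 'd \<Rightarrow> (int ^ 'd \<Rightarrow> complex) \<Rightarrow> real" where
  "J_real_grid c P N Q = Re (pairing \<Lambda> c Q) - grid_mean N (\<lambda>\<theta>. val P \<theta> * ln (val Q \<theta>))"

lemma log_integrand_continuous:
  assumes "\<And>\<theta>. 0 < val Q \<theta>"
  shows "continuous_on UNIV (\<lambda>\<theta>. val P \<theta> * ln (val Q \<theta>))"
proof -
  have "val Q \<theta> \<noteq> 0" for \<theta>
    using assms[of \<theta>] by simp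
  then show ?thesis
    by (intro continuous_intros continuous_on_id) simp
qed

lemma ext_integral_log:
  assumes "Q \<in> pos_cone \<Lambda>"
  shows "ext_integral torus_measure (\<lambda>\<theta>. ereal (val P \<theta> * ln (val Q \<theta>))) =
    ereal (integral\<^sup>L torus_measure (\<lambda>\<theta>. val P \<theta> * ln (val Q \<theta>)))"
  using assms unfolding pos_cone_iff
  by (intro ext_integral_ereal integrable_torus log_integrand_continuous) blast

lemma J_cont_pos_cone:
  assumes "Q \<in> pos_cone \<Lambda>"
  shows "J_cont \<Lambda> c P Q = ereal (J_real c P Q)"
proof -
  have "mult_log (val P \<theta>) (val Q \<theta>) = ereal (val P \<theta> * ln (val Q \<theta>))" for \<theta>
    using assms by (simp add: pos_cone_iff mult_log_pos)
  then show ?thesis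
    unfolding J_cont_def using ext_integral_log[OF assms]
    by (simp add: J_real_def torus_mean_def)
qed

lemma shift_in_pos_cone:
  "Q \<in> hermitian_seqs \<Lambda> \<Longrightarrow> (\<And>\<theta>. - e < val Q \<theta>) \<Longrightarrow> lin_comb 1 Q e unit_seq \<in> pos_cone \<Lambda>"
  by (simp add: pos_cone_iff hermitian_lin_comb hermitian_unit val_lin_comb val_unit) (smt (verit))

text \<open>\<open>Qhat\<close> may have zeros. Since \<open>P\<close> is nonnegative and the
  logarithm increases, shifting \<open>Qhat\<close> by \<open>e\<close> can only raise the integral
  that is subtracted, while the pairing grows by exactly \<open>e\<close> times that of
  \<open>unit_seq\<close>. The rest is minimality of \<open>Qhat\<close>.\<close>

lemma J_real_near_minimizer:
  assumes P: "P \<in> closure (pos_cone \<Lambda>)"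
    and min: "is_arg_min (J_cont \<Lambda> c P) (\<lambda>Q. Q \<in> closure (pos_cone \<Lambda>)) Qhat"
    and Q: "Q \<in> pos_cone \<Lambda>" and e: "0 < e"
  shows "J_real c P (lin_comb 1 Qhat e unit_seq) \<le> J_real c P Q + e * Re (pairing \<Lambda> c unit_seq)"
proof -
  let ?Q = "lin_comb 1 Qhat e unit_seq" and ?k = "(1 / (2 * pi)) ^ CARD('d)"
  have Qhat: "Qhat \<in> hermitian_seqs \<Lambda>" "\<And>\<theta>. 0 \<le> val Qhat \<theta>"
    using min by (simp_all add: is_arg_min_def closure_pos_cone)
  have pos: "?Q \<in> pos_cone \<Lambda>"
    using Qhat e by (intro shift_in_pos_cone) (auto intro: less_le_trans[of "- e" 0])
  define I where "I = ext_integral torus_measure (\<lambda>\<theta>. mult_log (val P \<theta>) (val Qhat \<theta>))"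
  have "J_cont \<Lambda> c P Qhat \<le> J_cont \<Lambda> c P Q"
    using min Q closure_subset[of "pos_cone \<Lambda>"] by (auto simp: is_arg_min_def not_less)
  then have le: "ereal (Re (pairing \<Lambda> c Qhat)) - ereal ?k * I \<le> ereal (J_real c P Q)"
    unfolding J_cont_pos_cone[OF Q] by (simp add: J_cont_def I_def)
  have "I \<le> ext_integral torus_measure (\<lambda>\<theta>. ereal (val P \<theta> * ln (val ?Q \<theta>)))"
    unfolding I_def
  proof (intro ext_integral_mono mult_log_mono)
    fix \<theta> show "0 \<le> val P \<theta>" "val Qhat \<theta> \<le> val ?Q \<theta>" "0 < val ?Q \<theta>"
      using P e pos by (simp_all add: closure_pos_cone pos_cone_iff val_lin_comb val_unit)
  qed
  then have "I \<le> ereal (integral\<^sup>L torus_measure (\<lambda>\<theta>. val P \<theta> * ln (val ?Q \<theta>)))"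
    unfolding ext_integral_log[OF pos] .
  from ereal_minus_mult_le[OF le this] show ?thesis
    by (simp add: J_real_def torus_mean_def pairing_lin_comb)
qed

lemma sum_mult_log:
  assumes "\<And>l. l \<in> grid N \<Longrightarrow> 0 < val Q (grid_angle N l)"
  shows "(\<Sum>l\<in>grid N. mult_log (val P (grid_angle N l)) (val Q (grid_angle N l))) =
    ereal (\<Sum>l\<in>grid N. val P (grid_angle N l) * ln (val Q (grid_angle N l)))"
  using assms by (simp add: mult_log_pos flip: sum_ereal)

lemma J_grid_pos_cone:
  assumes "Q \<in> pos_cone \<Lambda>"
  shows "J_grid \<Lambda> c P N Q = ereal (J_real_grid c P N Q)"
  using assms by (simp add: J_grid_def J_real_grid_def grid_mean_def sum_mult_log pos_cone_iff)

text \<open>The same comparison for sums. The shifted polynomial is positive at the grid points, the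
  only angles at which the grid functional evaluates it, but it may be negative between
  them.\<close>

lemma J_real_grid_near_minimizer:
  assumes P: "P \<in> closure (pos_cone \<Lambda>)" and N: "\<And>j. 0 < N $ j"
    and min: "is_arg_min (J_grid \<Lambda> c P N) (\<lambda>Q. Q \<in> closure (pos_cone_grid \<Lambda> N)) q"
    and Q: "Q \<in> pos_cone \<Lambda>" and e: "0 < e"
  shows "J_real_grid c P N (lin_comb 1 q e unit_seq) \<le> J_real_grid c P N Q + e * Re (pairing \<Lambda> c unit_seq)"
proof -
  let ?q = "lin_comb 1 q e unit_seq" and ?k = "1 / (\<Prod>j\<in>UNIV. real (N $ j))"
  have "q \<in> closure (pos_cone_grid \<Lambda> N)"
    using min by (simp add: is_arg_min_def)
  note q = closure_pos_cone_grid[OF this]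
  have pos: "0 < val ?q (grid_angle N l)" if "l \<in> grid N" for l
    using q(2)[OF that] e by (simp add: val_lin_comb val_unit)
  define S where "S = (\<Sum>l\<in>grid N. mult_log (val P (grid_angle N l)) (val q (grid_angle N l)))"
  have "Q \<in> pos_cone_grid \<Lambda> N"
    using Q by (simp add: pos_cone_iff pos_cone_grid_def)
  then have "J_grid \<Lambda> c P N q \<le> J_grid \<Lambda> c P N Q"
    using min closure_subset[of "pos_cone_grid \<Lambda> N"] by (auto simp: is_arg_min_def not_less)
  then have le: "ereal (Re (pairing \<Lambda> c q)) - ereal ?k * S \<le> ereal (J_real_grid c P N Q)"
    unfolding J_grid_pos_cone[OF Q] by (simp add: J_grid_def S_def)
  have "S \<le> (\<Sum>l\<in>grid N. ereal (val P (grid_angle N l) * ln (val ?q (grid_angle N l))))"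
    unfolding S_def
  proof (intro sum_mono mult_log_mono)
    fix l assume l: "l \<in> grid N"
    show "0 \<le> val P (grid_angle N l)" "val q (grid_angle N l) \<le> val ?q (grid_angle N l)"
      using P e by (simp_all add: closure_pos_cone val_lin_comb val_unit)
    show "0 < val ?q (grid_angle N l)"
      by (rule pos[OF l])
  qed
  then have S: "S \<le> ereal (\<Sum>l\<in>grid N. val P (grid_angle N l) * ln (val ?q (grid_angle N l)))"
    by simp
  have "0 < ?k"
    using N by (simp add: prod_pos)
  from ereal_minus_mult_le[OF le S this] show ?thesis
    by (simp add: J_real_grid_def grid_mean_def pairing_lin_comb)
qed

section \<open>Rates of convergence of the Riemann sums\<close>

text \<open>The logarithm of \<open>val A\<close> is bounded by \<open>1 / \<delta> + R\<close> and
  oscillates by at most \<open>R * (max_freq * h) / \<delta>\<close>; the oscillation of the product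
  with \<open>val P\<close> gives the constant. As \<open>A\<close> enters only through
  \<open>\<delta>\<close> and \<open>R\<close>, the rate is uniform for an \<open>A\<close> that
  varies with \<open>N\<close>.\<close>

lemma log_mean_error:
  assumes N: "fine_grid N h" and A: "\<And>\<theta>. \<delta> \<le> val A \<theta>" "norm1 A \<le> R" and \<delta>: "0 < \<delta>"
  shows "\<bar>grid_mean N (\<lambda>\<theta>. val P \<theta> * ln (val A \<theta>)) - torus_mean (\<lambda>\<theta>. val P \<theta> * ln (val A \<theta>))\<bar>
    \<le> norm1 P * max_freq * (1 / \<delta> + R + R / \<delta>) * h"
proof (rule riemann_sum_error[OF N])
  show "continuous_on UNIV (\<lambda>\<theta>. val P \<theta> * ln (val A \<theta>))"
    using A(1) \<delta> by (intro log_integrand_continuous) (rule less_le_trans)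
  show "periodic (\<lambda>\<theta>. val P \<theta> * ln (val A \<theta>))"
    by (rule periodic_comp2[OF val_periodic val_periodic])
  fix x y :: "real ^ 'd" assume near: "near h x y"
  have "\<bar>val A x - val A y\<bar> / \<delta> \<le> R * (max_freq * h) / \<delta>"
  proof (intro divide_right_mono)
    have "0 \<le> h"
      using near unfolding near_def by (meson abs_ge_zero order_trans)
    then show "\<bar>val A x - val A y\<bar> \<le> R * (max_freq * h)"
      using A(2) max_freq_nonneg by (intro order_trans[OF val_osc[OF near]] mult_right_mono) auto
  qed (use \<delta> in simp)
  then have "\<bar>ln (val A x) - ln (val A y)\<bar> \<le> R * (max_freq * h) / \<delta>"
    using ln_lipschitz[OF \<delta> A(1) A(1), of x y] by linarith
  moreover have "val A x \<le> R"
    using val_bound[of A x] A(2) by linarith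
  ultimately have "\<bar>val P x * ln (val A x) - val P y * ln (val A y)\<bar> \<le>
      norm1 P * (max_freq * h) * (1 / \<delta> + R) + norm1 P * (R * (max_freq * h) / \<delta>)"
    by (intro product_osc val_osc[OF near] val_bound ln_abs_bound \<delta> A(1))
  also have "\<dots> = norm1 P * max_freq * (1 / \<delta> + R + R / \<delta>) * h"
    by (simp add: algebra_simps)
  finally show "\<bar>val P x * ln (val A x) - val P y * ln (val A y)\<bar> \<le> \<dots>" .
qed

text \<open>The factor \<open>3\<close> counts the oscillation of \<open>val P\<close> once and that
  of \<open>val D\<close> twice.\<close>

lemma square_mean_error:
  assumes N: "fine_grid N h" and D: "norm1 D \<le> R"
  shows "\<bar>grid_mean N (\<lambda>\<theta>. val P \<theta> * (val D \<theta>)\<^sup>2) - torus_mean (\<lambda>\<theta>. val P \<theta> * (val D \<theta>)\<^sup>2)\<bar>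
    \<le> 3 * norm1 P * max_freq * R\<^sup>2 * h"
proof (rule riemann_sum_error[OF N])
  show "continuous_on UNIV (\<lambda>\<theta>. val P \<theta> * (val D \<theta>)\<^sup>2)"
    by (intro continuous_intros continuous_on_id)
  show "periodic (\<lambda>\<theta>. val P \<theta> * (val D \<theta>)\<^sup>2)"
    by (rule periodic_comp2[OF val_periodic val_periodic])
  fix x y :: "real ^ 'd" assume near: "near h x y"
  have "0 \<le> h"
    using near unfolding near_def by (meson abs_ge_zero order_trans)
  then have osc: "\<bar>val D x - val D y\<bar> \<le> R * (max_freq * h)"
    using D max_freq_nonneg by (intro order_trans[OF val_osc[OF near]] mult_right_mono) auto
  have bd: "\<bar>val D \<theta>\<bar> \<le> R" for \<theta>
    using val_bound[of D \<theta>] D by linarith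
  have "\<bar>val D x * val D x - val D y * val D y\<bar> \<le> R * (max_freq * h) * R + R * (R * (max_freq * h))"
    by (intro product_osc osc bd)
  moreover have "\<bar>val D x * val D x\<bar> \<le> R * R"
    unfolding abs_mult by (intro mult_mono bd) (auto intro: order_trans[OF abs_ge_zero bd])
  ultimately have "\<bar>val P x * (val D x * val D x) - val P y * (val D y * val D y)\<bar> \<le>
      norm1 P * (max_freq * h) * (R * R) + norm1 P * (R * (max_freq * h) * R + R * (R * (max_freq * h)))"
    by (intro product_osc[OF val_osc[OF near] _ val_bound])
  also have "\<dots> = 3 * norm1 P * max_freq * R\<^sup>2 * h"
    by (simp add: algebra_simps power2_eq_square)
  finally show "\<bar>val P x * (val D x)\<^sup>2 - val P y * (val D y)\<^sup>2\<bar> \<le> \<dots>"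
    by (simp add: power2_eq_square)
qed

section \<open>Boundedness of the grid minimizers\<close>

text \<open>Within \<open>h\<close> of \<open>\<theta>\<close> lies a translate of a grid point,
  where \<open>q\<close> is nonnegative, so the value at \<open>\<theta>\<close> falls below zero by
  at most the oscillation of \<open>q\<close>.\<close>

lemma val_ge_of_grid:
  assumes "fine_grid N h" "q \<in> closure (pos_cone_grid \<Lambda> N)"
  shows "- (norm1 q * (max_freq * h)) \<le> val q \<theta>"
proof -
  obtain l y where "l \<in> grid N" "near h \<theta> y" "val q y = val q (grid_angle N l)"
    using rounding_grid[OF assms(1) val_periodic] by blast
  then show ?thesis
    using closure_pos_cone_grid(2)[OF assms(2), of l] val_osc[of h \<theta> y q] by linarith
qed

text \<open>The constant \<open>s\<close> lifts \<open>q\<close> into the closed cone of the torus,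
  where coercivity with \<open>\<alpha>\<close> holds. Undoing the lift costs
  \<open>s * (\<alpha> + ?c0)\<close>, which the condition on \<open>h\<close> keeps below
  \<open>\<alpha> / 2 * norm1 q\<close>.\<close>

lemma grid_coercive:
  assumes \<alpha>: "0 < \<alpha>" "\<And>q. q \<in> closure (pos_cone \<Lambda>) \<Longrightarrow> \<alpha> * norm1 q \<le> Re (pairing \<Lambda> c q)"
    and N: "fine_grid N h" and h: "max_freq * (\<alpha> + Re (pairing \<Lambda> c unit_seq)) * h \<le> \<alpha> / 2"
    and q: "q \<in> closure (pos_cone_grid \<Lambda> N)"
  shows "\<alpha> / 2 * norm1 q \<le> Re (pairing \<Lambda> c q)"
proof -
  let ?c0 = "Re (pairing \<Lambda> c unit_seq)"
  define s where "s = norm1 q * (max_freq * h)"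
  have "0 < h"
    by (rule fine_grid_pos[OF N])
  then have s: "0 \<le> s"
    using max_freq_nonneg l1_norm_nonneg[of \<Lambda> q] by (simp add: s_def)
  define q' where "q' = lin_comb 1 q s unit_seq"
  have "q' \<in> closure (pos_cone \<Lambda>)"
    using closure_pos_cone_grid(1)[OF q] val_ge_of_grid[OF N q]
    by (simp add: q'_def closure_pos_cone hermitian_lin_comb hermitian_unit val_lin_comb val_unit s_def)
      (smt (verit))
  then have "\<alpha> * norm1 q' \<le> Re (pairing \<Lambda> c q) + s * ?c0"
    using \<alpha>(2)[of q'] by (simp add: q'_def pairing_lin_comb)
  moreover have "norm1 q \<le> norm1 q' + s"
  proof -
    have "q = lin_comb 1 q' (- s) unit_seq"
      by (simp add: q'_def lin_comb_def fun_eq_iff)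
    then have "norm1 q \<le> \<bar>1\<bar> * norm1 q' + \<bar>- s\<bar> * norm1 unit_seq"
      by (metis l1_norm_lin_comb)
    then show ?thesis
      using s by (simp add: norm1_unit)
  qed
  then have "\<alpha> * norm1 q \<le> \<alpha> * (norm1 q' + s)"
    using \<alpha>(1) by simp
  moreover have "s * (\<alpha> + ?c0) \<le> \<alpha> / 2 * norm1 q"
    using mult_left_mono[OF h l1_norm_nonneg[of \<Lambda> q]] by (simp add: s_def mult_ac)
  ultimately show ?thesis
    by (simp add: algebra_simps)
qed

lemma dual_cone_unit_pos:
  assumes "c \<in> dual_cone \<Lambda>"
  shows "0 < Re (pairing \<Lambda> c unit_seq)"
proof -
  have "unit_seq \<in> closure (pos_cone \<Lambda>)"
    by (simp add: closure_pos_cone hermitian_unit val_unit)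
  moreover have "unit_seq \<noteq> (\<lambda>_ :: int ^ 'd. 0)"
    unfolding unit_seq_def by (metis one_neq_zero)
  ultimately show ?thesis
    using assms by (simp add: dual_cone_def)
qed

text \<open>Comparing the minimizer shifted by \<open>1\<close> with the constant polynomial
  \<open>1\<close>, whose logarithm vanishes, bounds the pairing of \<open>c\<close> and
  \<open>q\<close> by a constant plus a multiple of \<open>ln (1 + norm1 q)\<close>. On fine grids
  the pairing grows linearly in \<open>norm1 q\<close>, so \<open>norm1 q\<close> is
  bounded.\<close>

lemma grid_minimizers_bounded:
  assumes c: "c \<in> dual_cone \<Lambda>" and P: "P \<in> closure (pos_cone \<Lambda>)"
  shows "\<exists>R. \<forall>\<^sub>F N in min_at_top. \<forall>q.
    is_arg_min (J_grid \<Lambda> c P N) (\<lambda>Q. Q \<in> closure (pos_cone_grid \<Lambda> N)) q \<longrightarrow> norm1 q \<le> R"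
proof -
  let ?c0 = "Re (pairing \<Lambda> c unit_seq)"
  have c0: "0 < ?c0"
    by (rule dual_cone_unit_pos[OF c])
  obtain \<alpha> where \<alpha>: "0 < \<alpha>" "\<And>q. q \<in> closure (pos_cone \<Lambda>) \<Longrightarrow> \<alpha> * norm1 q \<le> Re (pairing \<Lambda> c q)"
    using dual_cone_coercive[OF c] by blast
  obtain h where h: "0 < h" "max_freq * (\<alpha> + ?c0) * h \<le> \<alpha> / 2"
    using exists_small_multiple[of "max_freq * (\<alpha> + ?c0)" "\<alpha> / 2"] \<alpha>(1) c0 max_freq_nonneg by auto
  obtain R where R: "\<And>x. 0 \<le> x \<Longrightarrow> \<alpha> / 2 * x \<le> ?c0 + norm1 P * ln (1 + x) \<Longrightarrow> x \<le> R"
    using sublinear_bound[of "\<alpha> / 2" "norm1 P" ?c0] \<alpha>(1) l1_norm_nonneg[of \<Lambda> P] by auto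
  show ?thesis
  proof (intro exI[of _ R] eventually_mono[OF eventually_fine[OF h(1)]] allI impI)
    fix N q
    assume N: "fine_grid N h"
      and min: "is_arg_min (J_grid \<Lambda> c P N) (\<lambda>Q. Q \<in> closure (pos_cone_grid \<Lambda> N)) q"
    have pos: "0 < N $ j" for j
      using N by (simp add: fine_grid_def)
    have q: "q \<in> closure (pos_cone_grid \<Lambda> N)"
      using min by (simp add: is_arg_min_def)
    \<comment> \<open>The shift by \<open>1\<close> also makes the logarithms at the grid points
      nonnegative, as the product estimate below requires.\<close>
    let ?q = "lin_comb 1 q 1 unit_seq"
    have "J_real_grid c P N ?q \<le> J_real_grid c P N unit_seq + 1 * ?c0"
      by (rule J_real_grid_near_minimizer[OF P pos min]) (simp_all add: pos_cone_iff hermitian_unit val_unit)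
    then have "Re (pairing \<Lambda> c q) \<le> ?c0 + grid_mean N (\<lambda>\<theta>. val P \<theta> * ln (val ?q \<theta>))"
      by (simp add: J_real_grid_def val_unit grid_mean_const[OF pos] pairing_lin_comb)
    also have "grid_mean N (\<lambda>\<theta>. val P \<theta> * ln (val ?q \<theta>)) \<le> grid_mean N (\<lambda>_. norm1 P * ln (1 + norm1 q))"
    proof (intro grid_mean_mono mult_mono)
      fix l assume l: "l \<in> grid N"
      have v: "0 \<le> val q (grid_angle N l)" "val q (grid_angle N l) \<le> norm1 q"
        using closure_pos_cone_grid(2)[OF q l] val_bound[of q "grid_angle N l"] by auto
      then show "ln (val ?q (grid_angle N l)) \<le> ln (1 + norm1 q)" "0 \<le> ln (val ?q (grid_angle N l))"
        by (simp_all add: val_lin_comb val_unit)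
      show "val P (grid_angle N l) \<le> norm1 P"
        using val_bound[of P "grid_angle N l"] by simp
    qed (rule l1_norm_nonneg)
    also have "\<dots> = norm1 P * ln (1 + norm1 q)"
      by (rule grid_mean_const[OF pos])
    finally have "\<alpha> / 2 * norm1 q \<le> ?c0 + norm1 P * ln (1 + norm1 q)"
      using grid_coercive[OF \<alpha> N h(2) q] by simp
    then show "norm1 q \<le> R"
      by (intro R l1_norm_nonneg)
  qed
qed

section \<open>Convergence of the minimizers\<close>

text \<open>The gap of the strongly concave logarithm at the midpoint of the two regularized minimizers is
  paid for by the near-minimality of each: \<open>q + e\<close> for the sums, \<open>Qhat + e\<close> for the integral.\<close>

lemma minimizer_gap:
  assumes P: "P \<in> closure (pos_cone \<Lambda>)"
    and minQ: "is_arg_min (J_cont \<Lambda> c P) (\<lambda>Q. Q \<in> closure (pos_cone \<Lambda>)) Qhat"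
    and N: "fine_grid N h"
    and minq: "is_arg_min (J_grid \<Lambda> c P N) (\<lambda>Q. Q \<in> closure (pos_cone_grid \<Lambda> N)) q"
    and R: "norm1 Qhat \<le> R" "norm1 q \<le> R" and e: "0 < e" "e \<le> 1" "R * (max_freq * h) \<le> e / 2"
  shows "grid_mean N (\<lambda>\<theta>. val P \<theta> * (val (lin_comb 1 q (-1) Qhat) \<theta>)\<^sup>2) \<le>
    8 * (R + 1)\<^sup>2 * (3 / 2 * e * Re (pairing \<Lambda> c unit_seq) +
      norm1 P * max_freq * (2 / e + (R + 1) + (R + 1) * 2 / e) * h)"
proof -
  let ?c0 = "Re (pairing \<Lambda> c unit_seq)"
  define A where "A = lin_comb 1 q e unit_seq"
  define B where "B = lin_comb 1 Qhat e unit_seq"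
  define M where "M = lin_comb (1 / 2) A (1 / 2) B"
  define D where "D = lin_comb 1 q (-1) Qhat"
  \<comment> \<open>The error in \<open>log_mean_error\<close> for \<open>\<delta> = e / 2\<close>
    and the norm bound \<open>R + 1\<close>, both of which fit \<open>A\<close> as well as
    \<open>B\<close>.\<close>
  define \<eta> where "\<eta> = norm1 P * max_freq * (2 / e + (R + 1) + (R + 1) * 2 / e) * h"
  have pos: "0 < N $ j" for j
    using N by (simp add: fine_grid_def)
  have h: "0 < h"
    by (rule fine_grid_pos[OF N])
  have R0: "0 \<le> R"
    using R(1) l1_norm_nonneg[of \<Lambda> Qhat] by linarith
  have Pn: "0 \<le> val P \<theta>" for \<theta>
    using P by (simp add: closure_pos_cone)
  have Qhat: "Qhat \<in> hermitian_seqs \<Lambda>" "\<And>\<theta>. 0 \<le> val Qhat \<theta>"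
    using minQ by (simp_all add: is_arg_min_def closure_pos_cone)
  have qc: "q \<in> closure (pos_cone_grid \<Lambda> N)"
    using minq by (simp add: is_arg_min_def)
  \<comment> \<open>Between grid points \<open>q\<close> drops below zero by at most
    \<open>e / 2\<close>, which leaves the other half of the shift.\<close>
  have vA: "e / 2 \<le> val A \<theta>" for \<theta>
  proof -
    have "norm1 q * (max_freq * h) \<le> R * (max_freq * h)"
      using R(2) max_freq_nonneg h by (intro mult_right_mono) auto
    then show ?thesis
      using val_ge_of_grid[OF N qc, of \<theta>] e by (simp add: A_def val_lin_comb val_unit)
  qed
  have vB: "e / 2 \<le> val B \<theta>" for \<theta>
    using Qhat(2)[of \<theta>] e by (simp add: B_def val_lin_comb val_unit)
  have nA: "norm1 A \<le> R + 1" and nB: "norm1 B \<le> R + 1"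
    using l1_norm_lin_comb[of \<Lambda> 1 q e unit_seq] l1_norm_lin_comb[of \<Lambda> 1 Qhat e unit_seq] R e
    by (simp_all add: A_def B_def norm1_unit)
  have hA: "A \<in> hermitian_seqs \<Lambda>" and hB: "B \<in> hermitian_seqs \<Lambda>"
    using Qhat(1) closure_pos_cone_grid(1)[OF qc]
    by (simp_all add: A_def B_def hermitian_lin_comb hermitian_unit)
  have A: "A \<in> pos_cone \<Lambda>" and M: "M \<in> pos_cone \<Lambda>"
  proof -
    have "0 < val A \<theta>" "0 < val B \<theta>" for \<theta>
      using vA[of \<theta>] vB[of \<theta>] e(1) by linarith+
    then show "A \<in> pos_cone \<Lambda>" "M \<in> pos_cone \<Lambda>"
      using hA hB by (auto simp: pos_cone_iff M_def hermitian_lin_comb val_lin_comb add_pos_pos)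
  qed
  let ?L = "\<lambda>Q. grid_mean N (\<lambda>\<theta>. val P \<theta> * ln (val Q \<theta>))"
  have "grid_mean N (\<lambda>\<theta>. 1 / 2 * (val P \<theta> * ln (val A \<theta>)) + 1 / 2 * (val P \<theta> * ln (val B \<theta>)) +
      1 / (8 * (R + 1)\<^sup>2) * (val P \<theta> * (val D \<theta>)\<^sup>2)) \<le> ?L M"
  proof (rule grid_mean_mono)
    fix l
    let ?x = "grid_angle N l"
    have "val A ?x - val B ?x = val D ?x"
      by (simp add: A_def B_def D_def val_lin_comb)
    moreover have "0 < val A ?x" "0 < val B ?x"
      using vA[of ?x] vB[of ?x] e(1) by linarith+
    moreover have "val A ?x \<le> R + 1" "val B ?x \<le> R + 1"
      using val_bound[of A ?x] val_bound[of B ?x] nA nB by linarith+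
    ultimately have "(ln (val A ?x) + ln (val B ?x)) / 2 + (val D ?x)\<^sup>2 / (8 * (R + 1)\<^sup>2) \<le> ln (val M ?x)"
      using ln_midpoint_ge[of "val A ?x" "val B ?x" "R + 1"] by (simp add: M_def val_lin_comb)
    from mult_left_mono[OF this Pn[of ?x]]
    show "1 / 2 * (val P ?x * ln (val A ?x)) + 1 / 2 * (val P ?x * ln (val B ?x)) +
      1 / (8 * (R + 1)\<^sup>2) * (val P ?x * (val D ?x)\<^sup>2) \<le> val P ?x * ln (val M ?x)"
      by (simp add: distrib_left add_divide_distrib)
  qed
  then have "1 / 2 * ?L A + 1 / 2 * ?L B +
      1 / (8 * (R + 1)\<^sup>2) * grid_mean N (\<lambda>\<theta>. val P \<theta> * (val D \<theta>)\<^sup>2) \<le> ?L M"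
    by (simp only: grid_mean_add grid_mean_mult)
  moreover have "J_real_grid c P N A \<le> J_real_grid c P N M + e * ?c0"
    unfolding A_def by (rule J_real_grid_near_minimizer[OF P pos minq M e(1)])
  moreover have "J_real c P B \<le> J_real c P A + e * ?c0"
    unfolding B_def by (rule J_real_near_minimizer[OF P minQ A e(1)])
  moreover have "Re (pairing \<Lambda> c M) = 1 / 2 * Re (pairing \<Lambda> c A) + 1 / 2 * Re (pairing \<Lambda> c B)"
    by (simp only: M_def pairing_lin_comb)
  moreover have "\<bar>?L A - torus_mean (\<lambda>\<theta>. val P \<theta> * ln (val A \<theta>))\<bar> \<le> \<eta>"
    using log_mean_error[OF N vA nA, of P] e(1) by (simp add: \<eta>_def)
  moreover have "\<bar>?L B - torus_mean (\<lambda>\<theta>. val P \<theta> * ln (val B \<theta>))\<bar> \<le> \<eta>"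
    using log_mean_error[OF N vB nB, of P] e(1) by (simp add: \<eta>_def)
  \<comment> \<open>Near-minimality of \<open>A\<close> against \<open>M\<close> bounds the gap by
    half the difference of the grid functionals at \<open>B\<close> and \<open>A\<close> plus
    \<open>e * ?c0\<close>. Passing to the integral functionals changes that difference by at most
    \<open>2 * \<eta>\<close>, and near-minimality of \<open>B\<close> against \<open>A\<close>
    bounds it there by \<open>e * ?c0\<close>. This is where the factor \<open>3 / 2\<close> comes
    from.\<close>
  ultimately have "1 / (8 * (R + 1)\<^sup>2) * grid_mean N (\<lambda>\<theta>. val P \<theta> * (val D \<theta>)\<^sup>2) \<le> 3 / 2 * e * ?c0 + \<eta>"
    unfolding J_real_def J_real_grid_def by linarith
  then have le: "grid_mean N (\<lambda>\<theta>. val P \<theta> * (val D \<theta>)\<^sup>2) / (8 * (R + 1)\<^sup>2) \<le> 3 / 2 * e * ?c0 + \<eta>"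
    by simp
  have "0 < 8 * (R + 1)\<^sup>2"
    using R0 by simp
  from le[unfolded pos_divide_le_eq[OF this]] show ?thesis
    by (simp only: D_def \<eta>_def mult.commute)
qed

text \<open>The constant \<open>\<kappa>\<close> turns smallness of the weighted mean square into
  smallness of the coefficients of the difference. The shift \<open>e\<close> is fixed before the
  mesh size \<open>h\<close>, because the Riemann sum error contains \<open>1 / e\<close>.\<close>

lemma grid_minimizers_converge:
  assumes c: "c \<in> dual_cone \<Lambda>" and P: "P \<in> closure (pos_cone \<Lambda>)" "P \<noteq> (\<lambda>_. 0)"
    and minQ: "is_arg_min (J_cont \<Lambda> c P) (\<lambda>Q. Q \<in> closure (pos_cone \<Lambda>)) Qhat"
    and \<epsilon>: "0 < \<epsilon>"
  shows "\<forall>\<^sub>F N in min_at_top. \<forall>q.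
    is_arg_min (J_grid \<Lambda> c P N) (\<lambda>Q. Q \<in> closure (pos_cone_grid \<Lambda> N)) q \<longrightarrow>
      norm1 (lin_comb 1 q (-1) Qhat) < \<epsilon>"
proof -
  let ?c0 = "Re (pairing \<Lambda> c unit_seq)"
  have c0: "0 < ?c0"
    by (rule dual_cone_unit_pos[OF c])
  obtain R0 where bd: "\<forall>\<^sub>F N in min_at_top. \<forall>q.
      is_arg_min (J_grid \<Lambda> c P N) (\<lambda>Q. Q \<in> closure (pos_cone_grid \<Lambda> N)) q \<longrightarrow> norm1 q \<le> R0"
    using grid_minimizers_bounded[OF c P(1)] by (elim exE)
  obtain \<kappa> where \<kappa>: "0 < \<kappa>"
    "\<And>D. D \<in> hermitian_seqs \<Lambda> \<Longrightarrow> \<kappa> * (norm1 D)\<^sup>2 \<le> torus_mean (\<lambda>\<theta>. val P \<theta> * (val D \<theta>)\<^sup>2)"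
    using weighted_square_coercive[OF c P] by blast
  define R where "R = max R0 (norm1 Qhat)"
  have R: "0 \<le> R" "norm1 Qhat \<le> R" "R0 \<le> R"
    using l1_norm_nonneg[of \<Lambda> Qhat] by (auto simp: R_def)
  \<comment> \<open>The error from the shift and the error from the mesh each receive one third of
    the target; the remaining third makes the final inequality strict.\<close>
  define b where "b = \<kappa> * \<epsilon>\<^sup>2 / 3"
  have b: "0 < b"
    using \<kappa> \<epsilon> by (simp add: b_def)
  obtain e0 where e0: "0 < e0" "8 * (R + 1)\<^sup>2 * (3 / 2 * ?c0) * e0 \<le> b"
    using exists_small_multiple[of "8 * (R + 1)\<^sup>2 * (3 / 2 * ?c0)" b] c0 b by auto
  define e where "e = min 1 e0"
  have "8 * (R + 1)\<^sup>2 * (3 / 2 * ?c0) * e \<le> 8 * (R + 1)\<^sup>2 * (3 / 2 * ?c0) * e0"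
    using c0 by (intro mult_left_mono) (auto simp: e_def)
  then have e: "0 < e" "e \<le> 1" "8 * (R + 1)\<^sup>2 * (3 / 2 * ?c0) * e \<le> b"
    using e0 by (auto simp: e_def)
  \<comment> \<open>All coefficients of \<open>h\<close>: the logarithmic error in
    \<open>minimizer_gap\<close> and the error of the mean square, where the difference has norm at
    most \<open>2 * R\<close>.\<close>
  define K where "K = 8 * (R + 1)\<^sup>2 * (norm1 P * max_freq * (2 / e + (R + 1) + (R + 1) * 2 / e)) +
    3 * norm1 P * max_freq * (2 * R)\<^sup>2"
  have K: "0 \<le> K"
    unfolding K_def using R(1) e(1) max_freq_nonneg l1_norm_nonneg[of \<Lambda> P]
    by (intro add_nonneg_nonneg mult_nonneg_nonneg divide_nonneg_nonneg) auto
  obtain h1 where h1: "0 < h1" "K * h1 \<le> b"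
    using exists_small_multiple[OF K b] by blast
  \<comment> \<open>This mesh size keeps the shifted grid minimizer above \<open>e / 2\<close> on
    the whole torus, as \<open>minimizer_gap\<close> requires.\<close>
  obtain h2 where h2: "0 < h2" "R * max_freq * h2 \<le> e / 2"
    using exists_small_multiple[of "R * max_freq" "e / 2"] R(1) e(1) max_freq_nonneg by auto
  define h where "h = min h1 h2"
  have "0 < h"
    using h1 h2 by (simp add: h_def)
  show ?thesis
  proof (rule eventually_elim2[OF eventually_fine[OF \<open>0 < h\<close>] bd], intro allI impI)
    fix N q
    assume N: "fine_grid N h"
      and min: "is_arg_min (J_grid \<Lambda> c P N) (\<lambda>Q. Q \<in> closure (pos_cone_grid \<Lambda> N)) q"
      and bdN: "\<forall>q. is_arg_min (J_grid \<Lambda> c P N) (\<lambda>Q. Q \<in> closure (pos_cone_grid \<Lambda> N)) q \<longrightarrow> norm1 q \<le> R0"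
    let ?D = "lin_comb 1 q (-1) Qhat"
    have q: "norm1 q \<le> R"
      using bdN[rule_format, OF min] R(3) by (rule order_trans)
    have "K * h \<le> K * h1" "R * max_freq * h \<le> R * max_freq * h2"
      using K R(1) max_freq_nonneg by (auto simp: h_def intro!: mult_left_mono)
    then have Kh: "K * h \<le> b" and Rh: "R * (max_freq * h) \<le> e / 2"
      using h1 h2 by (auto simp: mult.assoc)
    have D: "?D \<in> hermitian_seqs \<Lambda>"
      using minQ min by (intro hermitian_lin_comb) (auto simp: is_arg_min_def closure_pos_cone
          dest: closure_pos_cone_grid(1))
    have nD: "norm1 ?D \<le> 2 * R"
      using l1_norm_lin_comb[of \<Lambda> 1 q "-1" Qhat] q R(2) by simp
    have "\<kappa> * (norm1 ?D)\<^sup>2 \<le> torus_mean (\<lambda>\<theta>. val P \<theta> * (val ?D \<theta>)\<^sup>2)"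
      by (rule \<kappa>(2)[OF D])
    also have "\<dots> \<le> grid_mean N (\<lambda>\<theta>. val P \<theta> * (val ?D \<theta>)\<^sup>2) + 3 * norm1 P * max_freq * (2 * R)\<^sup>2 * h"
      using square_mean_error[OF N nD, of P] by linarith
    also have "\<dots> \<le> 8 * (R + 1)\<^sup>2 * (3 / 2 * e * ?c0 +
        norm1 P * max_freq * (2 / e + (R + 1) + (R + 1) * 2 / e) * h) +
        3 * norm1 P * max_freq * (2 * R)\<^sup>2 * h"
      using minimizer_gap[OF P(1) minQ N min R(2) q e(1,2) Rh] by linarith
    also have "\<dots> = 8 * (R + 1)\<^sup>2 * (3 / 2 * ?c0) * e + K * h"
      by (simp only: K_def distrib_right distrib_left mult_ac add_ac)
    also have "\<dots> \<le> 2 * b"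
      using e(3) Kh by linarith
    also have "\<dots> < \<kappa> * \<epsilon>\<^sup>2"
      using b by (simp add: b_def)
    finally have "(norm1 ?D)\<^sup>2 < \<epsilon>\<^sup>2"
      using \<kappa>(1) by simp
    then show "norm1 ?D < \<epsilon>"
      by (rule power_less_imp_less_base) (use \<epsilon> in simp)
  qed
qed

end

theorem theorem2p6:
  fixes \<Lambda> :: "(int ^ 'd) set"
    and P c Qhat :: "int ^ 'd \<Rightarrow> complex"
    and Qhat_N :: "nat ^ 'd \<Rightarrow> (int ^ 'd \<Rightarrow> complex)"
  assumes "finite \<Lambda>" and "0 \<in> \<Lambda>" and "uminus ` \<Lambda> = \<Lambda>"
    and "P \<in> closure (pos_cone \<Lambda>) - {\<lambda>_. 0}"
    and "c \<in> dual_cone \<Lambda>"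
    and "is_arg_min (J_cont \<Lambda> c P) (\<lambda>Q. Q \<in> closure (pos_cone \<Lambda>)) Qhat"
    and "\<forall>\<^sub>F N in min_at_top.
           is_arg_min (J_grid \<Lambda> c P N) (\<lambda>Q. Q \<in> closure (pos_cone_grid \<Lambda> N)) (Qhat_N N)"
  shows "uniform_limit torus (\<lambda>N. trig_poly \<Lambda> (Qhat_N N)) (trig_poly \<Lambda> Qhat) min_at_top"
  unfolding uniform_limit_iff
proof (intro allI impI)
  interpret symmetric_index_set \<Lambda>
    by unfold_locales (fact assms)+
  fix \<epsilon> :: real assume \<epsilon>: "0 < \<epsilon>"
  have P: "P \<in> closure (pos_cone \<Lambda>)" "P \<noteq> (\<lambda>_. 0)"
    using assms(4) by auto
  have Qhat: "Qhat \<in> hermitian_seqs \<Lambda>"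
    using assms(6) by (simp add: is_arg_min_def closure_pos_cone)
  from assms(7) grid_minimizers_converge[OF assms(5) P assms(6) \<epsilon>]
  show "\<forall>\<^sub>F N in min_at_top. \<forall>\<theta>\<in>torus. dist (trig_poly \<Lambda> (Qhat_N N) \<theta>) (trig_poly \<Lambda> Qhat \<theta>) < \<epsilon>"
  proof eventually_elim
    case (elim N)
    then have q: "Qhat_N N \<in> hermitian_seqs \<Lambda>"
      by (auto simp: is_arg_min_def dest: closure_pos_cone_grid(1))
    show ?case
    proof
      fix \<theta> :: "real ^ 'd"
      \<comment> \<open>Both values are real, so their distance is the difference of the real parts.
        The bound by \<open>norm1\<close> does not depend on \<open>\<theta>\<close>, which gives
        uniformity.\<close>
      have "dist (trig_poly \<Lambda> (Qhat_N N) \<theta>) (trig_poly \<Lambda> Qhat \<theta>) = \<bar>val (Qhat_N N) \<theta> - val Qhat \<theta>\<bar>"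
        by (subst trig_poly_eq_val[OF q], subst trig_poly_eq_val[OF Qhat])
          (simp only: dist_norm norm_of_real flip: of_real_diff)
      also have "\<dots> = \<bar>val (lin_comb 1 (Qhat_N N) (-1) Qhat) \<theta>\<bar>"
        by (simp add: val_lin_comb)
      also have "\<dots> \<le> norm1 (lin_comb 1 (Qhat_N N) (-1) Qhat)"
        by (rule val_bound)
      also have "\<dots> < \<epsilon>"
        by (rule elim(2)[rule_format, OF elim(1)])
      finally show "dist (trig_poly \<Lambda> (Qhat_N N) \<theta>) (trig_poly \<Lambda> Qhat \<theta>) < \<epsilon>" .
    qed
  qed
qed

end
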